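(* Let $t>1$ be a fixed integer. There exists $N=N(t)$ such that for all $n\ge N$, $$\operatorname{sat}(K_{n,n},K_{t-1,t})=(2t-3)n-(t-1)(t-2).$$ Moreover, a $K_{t-1,t}$-saturated $n$ by $n$ bipartite graph $G$ has exactly $\operatorname{sat}(K_{n,n},K_{t-1,t})$ edges if and only if $G\in\mathcal{F}^n_{t-1,t}$.
   Context: An $n$ by $n$ bipartite graph $G$ has two color classes $U,U'$ with $|U|=|U'|=n$. For $1\le s\le t$, such a $G$ is called $K_{s,t}$-saturated if $G$ contains no subgraph isomorphic to $K_{s,t}$ (with either side of $K_{s,t}$ lying in either class $U$ or $U'$), but adding any missing edge $uu'$ with $u\in U$, $u'\in U'$ creates a subgraph isomorphic to $K_{s,t}$ (again with either orientation). $\operatorname{sat}(K_{n,n},K_{s,t})$ denotes the minimum number of edges of a $K_{s,t}$-saturated $n$ by $n$ bipartite graph. $\mathcal{F}^n_{s,t}$ denotes the family of $K_{s,t}$-free $n$ by $n$ bipartite graphs in which one of the color classes contains a set $S$ of $s-1$ vertices such that every vertex of $S$ is adjacent to all $n$ vertices of the other class, and every vertex of that same class not in $S$ has degree exactly $t-1$. *)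

theory Defs
  imports Main
begin

text \<open>An n by n bipartite graph: colour classes U = {..<n} and U' = {..<n} (two disjoint
copies); an edge u u' (u in U, u' in U') is represented by the pair (u, u').\<close>

definition bip_graph :: "nat \<Rightarrow> (nat \<times> nat) set \<Rightarrow> bool" where
  "bip_graph n E \<longleftrightarrow> E \<subseteq> {..<n} \<times> {..<n}"

definition contains_Kst :: "nat \<Rightarrow> nat \<Rightarrow> nat \<Rightarrow> (nat \<times> nat) set \<Rightarrow> bool" where
  "contains_Kst n s t E \<longleftrightarrow>
     (\<exists>A B. A \<subseteq> {..<n} \<and> B \<subseteq> {..<n} \<and>
        ((card A = s \<and> card B = t) \<or> (card A = t \<and> card B = s)) \<and> A \<times> B \<subseteq> E)"

definition Kst_saturated :: "nat \<Rightarrow> nat \<Rightarrow> nat \<Rightarrow> (nat \<times> nat) set \<Rightarrow> bool" where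
  "Kst_saturated n s t E \<longleftrightarrow> bip_graph n E \<and> \<not> contains_Kst n s t E \<and>
     (\<forall>p \<in> ({..<n} \<times> {..<n}) - E. contains_Kst n s t (insert p E))"

definition sat_bip :: "nat \<Rightarrow> nat \<Rightarrow> nat \<Rightarrow> nat" where
  "sat_bip n s t = Min (card ` {E. Kst_saturated n s t E})"

definition family_F :: "nat \<Rightarrow> nat \<Rightarrow> nat \<Rightarrow> (nat \<times> nat) set \<Rightarrow> bool" where
  "family_F n s t E \<longleftrightarrow> bip_graph n E \<and> \<not> contains_Kst n s t E \<and>
     ((\<exists>S. S \<subseteq> {..<n} \<and> card S = s - 1 \<and>
          (\<forall>u\<in>S. \<forall>v<n. (u, v) \<in> E) \<and>
          (\<forall>u<n. u \<notin> S \<longrightarrow> card {v. (u, v) \<in> E} = t - 1))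
      \<or>
      (\<exists>S. S \<subseteq> {..<n} \<and> card S = s - 1 \<and>
          (\<forall>v\<in>S. \<forall>u<n. (u, v) \<in> E) \<and>
          (\<forall>v<n. v \<notin> S \<longrightarrow> card {u. (u, v) \<in> E} = t - 1)))"

end

theory Submission
  imports Defs Complex_Main
begin

text \<open>
  Write \<open>k = t - 2\<close>, so that the forbidden graph is \<open>K\<^bsub>k+1,k+2\<^esub>\<close> and the target is
  \<open>(2k+1)n - k(k+1)\<close>. All degrees are at least \<open>k\<close>. If some vertex \<open>u\<close> has degree \<open>k\<close>, saturation gives
  every vertex outside \<open>N(u)\<close> at least \<open>k + 1\<close> neighbours that are complete to \<open>N(u)\<close>, and counting finishes.
  If all degrees are at least \<open>k + 1\<close>, it suffices to find \<open>k\<close> vertices of full degree in one class, or a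
  \<^emph>\<open>tight edge\<close>: an edge whose endpoints have degree \<open>k + 1\<close> and whose remaining neighbourhoods
  \<open>S\<close>, \<open>Q\<close> are complete to each other. For a tight edge the bound follows by comparing the non-edges at \<open>S\<close> and
  at \<open>Q\<close> with the surplus edges that saturation forces between the complements of \<open>S\<close> and \<open>Q\<close>.

  Otherwise both classes contain a vertex of degree at most \<open>2k\<close> (or there are too many edges). The
  neighbourhoods of two such vertices, enlarged by all vertices with \<open>k + 1\<close> neighbours in one of them, form
  bounded sets \<open>A\<close> and \<open>B\<close>. Counting edges relative to \<open>A\<close> and \<open>B\<close> shows, up to exchanging the
  classes, that all but boundedly many vertices of the first class have degree exactly \<open>k + 1\<close> and all but
  boundedly many vertices of the second have exactly \<open>k\<close> neighbours in \<open>A\<close>. Saturation between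
  such vertices then produces a tight edge or \<open>k\<close> vertices of full degree once \<open>n\<close> is large.
\<close>

section \<open>Edge counts\<close>

definition edges :: "('a \<times> 'b) set \<Rightarrow> 'a set \<Rightarrow> 'b set \<Rightarrow> nat" where
  "edges E X Y = card (E \<inter> X \<times> Y)"

lemma edges_left:
  assumes "finite X" "finite Y"
  shows "edges E X Y = (\<Sum>x\<in>X. card (E `` {x} \<inter> Y))"
proof -
  have "E \<inter> X \<times> Y = (SIGMA x:X. E `` {x} \<inter> Y)" by auto
  then show ?thesis unfolding edges_def using assms by (simp add: card_SigmaI)
qed

lemma edges_converse: "edges (E\<inverse>) Y X = edges E X Y"
proof -
  have "E\<inverse> \<inter> Y \<times> X = (E \<inter> X \<times> Y)\<inverse>" by auto
  then show ?thesis unfolding edges_def by (simp add: card_inverse)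
qed

lemma edges_right:
  assumes "finite X" "finite Y"
  shows "edges E X Y = (\<Sum>y\<in>Y. card (E\<inverse> `` {y} \<inter> X))"
  using edges_left[OF assms(2,1), of "E\<inverse>"] by (simp add: edges_converse)

lemma edges_Un_left:
  assumes "finite X" "finite X'" "finite Y" "X \<inter> X' = {}"
  shows "edges E (X \<union> X') Y = edges E X Y + edges E X' Y"
  using assms by (simp add: edges_left sum.union_disjoint)

lemma edges_Un_right:
  assumes "finite X" "finite Y'" "finite Y" "Y \<inter> Y' = {}"
  shows "edges E X (Y \<union> Y') = edges E X Y + edges E X Y'"
  using assms by (simp add: edges_right sum.union_disjoint)

lemma edges_pos:
  assumes "finite X" "finite Y" "(x, y) \<in> E" "x \<in> X" "y \<in> Y"
  shows "edges E X Y > 0"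
proof -
  have "finite (E \<inter> X \<times> Y)" using assms by simp
  moreover have "(x, y) \<in> E \<inter> X \<times> Y" using assms by blast
  ultimately show ?thesis unfolding edges_def by (metis card_gt_0_iff empty_iff)
qed

lemma card_le_sum_cover:
  assumes "finite I" "\<And>i. i \<in> I \<Longrightarrow> finite (F i)" "S \<subseteq> (\<Union>i\<in>I. F i)"
  shows "card S \<le> (\<Sum>i\<in>I. card (F i))"
proof -
  have "card S \<le> card (\<Union>i\<in>I. F i)" using assms by (intro card_mono) auto
  also have "\<dots> \<le> (\<Sum>i\<in>I. card (F i))" using assms(1) by (rule card_UN_le)
  finally show ?thesis .
qed

lemma ex_subset_card:
  assumes "finite A" "card A \<ge> m" shows "\<exists>B\<subseteq>A. card B = m"
  using assms obtain_subset_with_card_n by metis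

lemma card_Int_Diff_split: "finite A \<Longrightarrow> card A = card (A \<inter> B) + card (A - B)"
  by (subst card_Un_disjoint[symmetric]) (auto intro: arg_cong[of _ _ card])

lemma family_F_converse: "family_F n s t (E\<inverse>) \<longleftrightarrow> family_F n s t E"
proof -
  have 1: "bip_graph n (E\<inverse>) \<longleftrightarrow> bip_graph n E" by (auto simp: bip_graph_def)
  have 2: "contains_Kst n s t (E\<inverse>)" if "contains_Kst n s t E" for E
  proof -
    from that obtain A B where "A \<subseteq> {..<n}" "B \<subseteq> {..<n}"
      "(card A = s \<and> card B = t) \<or> (card A = t \<and> card B = s)" "A \<times> B \<subseteq> E"
      unfolding contains_Kst_def by blast
    then show ?thesis unfolding contains_Kst_def by (intro exI[of _ B] exI[of _ A]) auto
  qed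
  have 3: "contains_Kst n s t (E\<inverse>) \<longleftrightarrow> contains_Kst n s t E" using 2[of E] 2[of "E\<inverse>"] by auto
  show ?thesis unfolding family_F_def 1 3 converse_iff by (simp only: disj_commute)
qed

section \<open>Saturated graphs\<close>

locale saturated =
  fixes n k :: nat and E :: "(nat \<times> nat) set"
  assumes saturated: "Kst_saturated n (k + 1) (k + 2) E"
begin

lemma bip_graph: "bip_graph n E" and not_contains: "\<not> contains_Kst n (k + 1) (k + 2) E"
  and contains_insert: "u < n \<Longrightarrow> v < n \<Longrightarrow> (u, v) \<notin> E \<Longrightarrow>
    contains_Kst n (k + 1) (k + 2) (insert (u, v) E)"
  using saturated by (simp_all add: Kst_saturated_def)

abbreviation N :: "nat \<Rightarrow> nat set" where "N u \<equiv> E `` {u}"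
abbreviation M :: "nat \<Rightarrow> nat set" where "M v \<equiv> E\<inverse> `` {v}"

text \<open>Lower bound and equality case for this one graph, with \<open>k * (k + 1)\<close> moved
  to the side of the edges to avoid truncated subtraction.\<close>

definition good :: bool where
  "good \<longleftrightarrow> (2 * k + 1) * n \<le> card E + k * (k + 1) \<and>
     (card E + k * (k + 1) = (2 * k + 1) * n \<longrightarrow> family_F n (k + 1) (k + 2) E)"

lemma subset: "E \<subseteq> {..<n} \<times> {..<n}"
  using bip_graph by (simp add: bip_graph_def)

lemma finite_E [simp]: "finite E" by (rule finite_subset[OF subset]) simp

lemma N_subset: "N u \<subseteq> {..<n}" and M_subset: "M v \<subseteq> {..<n}" using subset by auto

lemma finite_N [simp]: "finite (N u)" and finite_M [simp]: "finite (M v)"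
  by (rule finite_subset[OF N_subset] finite_subset[OF M_subset]; simp)+

lemma edge_lt: "(u, v) \<in> E \<Longrightarrow> u < n" "(u, v) \<in> E \<Longrightarrow> v < n" using subset by auto

text \<open>Both orientations of the forbidden graph count, so the classes can be exchanged; every
  one-sided result below is mirrored through this.\<close>

lemma conv: "saturated n k (E\<inverse>)"
proof -
  have 1: "contains_Kst n s t (E\<inverse>)" if "contains_Kst n s t E" for s t E
  proof -
    from that obtain A B where "A \<subseteq> {..<n}" "B \<subseteq> {..<n}"
      "(card A = s \<and> card B = t) \<or> (card A = t \<and> card B = s)" "A \<times> B \<subseteq> E"
      unfolding contains_Kst_def by blast
    then show ?thesis unfolding contains_Kst_def by (intro exI[of _ B] exI[of _ A]) auto
  qed
  have 2: "\<not> contains_Kst n (k+1) (k+2) (E\<inverse>)" 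
    using 1[of "k+1" "k+2" "E\<inverse>"] not_contains by auto
  have 3: "contains_Kst n (k+1) (k+2) (insert p (E\<inverse>))"
    if "p \<in> {..<n} \<times> {..<n} - E\<inverse>" for p
  proof -
    obtain a b where p: "p = (a, b)" by (cases p)
    have "b < n" "a < n" "(b, a) \<notin> E" using that p by auto
    then have "contains_Kst n (k+1) (k+2) (insert (b, a) E)" by (rule contains_insert)
    moreover have "(insert (b, a) E)\<inverse> = insert p (E\<inverse>)" unfolding p by auto
    ultimately show ?thesis using 1 by metis
  qed
  have 4: "bip_graph n (E\<inverse>)" using subset by (auto simp: bip_graph_def)
  show ?thesis unfolding saturated_def Kst_saturated_def using 2 3 4 by simp
qed

lemma card_E_conv: "card (E\<inverse>) = card E" by (simp add: card_inverse)

lemma good_conv: "saturated.good n k (E\<inverse>) \<longleftrightarrow> good"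
  unfolding good_def saturated.good_def[OF conv] by (simp add: card_E_conv family_F_converse)

lemma free_right: "card A = k + 1 \<Longrightarrow> A \<times> B \<subseteq> E \<Longrightarrow> card B \<le> k + 1"
proof (rule ccontr)
  assume A: "card A = k + 1" "A \<times> B \<subseteq> E" "\<not> card B \<le> k + 1"
  then have "finite B" by (metis card.infinite le0)
  then obtain B' where B': "B' \<subseteq> B" "card B' = k + 2" using A ex_subset_card[of B "k+2"] by auto
  obtain a b where ab: "a \<in> A" "b \<in> B'" using A(1) B'(2) by fastforce
  have "A \<subseteq> {..<n}" using ab(2) A(2) B'(1) edge_lt(1) by blast
  moreover have "B' \<subseteq> {..<n}" using ab(1) A(2) B'(1) edge_lt(2) by blast
  ultimately  have "contains_Kst n (k+1) (k+2) E" unfolding contains_Kst_def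
    using A B' by (intro exI[of _ A] exI[of _ B']) auto
  then show False using not_contains by simp
qed

lemma free_left: "card B = k + 1 \<Longrightarrow> A \<times> B \<subseteq> E \<Longrightarrow> card A \<le> k + 1"
  using saturated.free_right[OF conv, of B A] by auto

text \<open>The copy created by the new edge uses both \<open>u\<close> and \<open>v\<close>;
  deleting them leaves a complete pair, and the orientation of the copy decides which side keeps
  \<open>k + 1\<close> vertices. The added-edge condition is used in this form from here on.\<close>

lemma missing:
  assumes "u < n" "v < n" "(u, v) \<notin> E"
  obtains A B where "A \<subseteq> M v" "B \<subseteq> N u" "A \<times> B \<subseteq> E"
    "card A = k \<and> card B = k + 1 \<or> card A = k + 1 \<and> card B = k"
proof -
  from contains_insert[OF assms] obtain A B where AB: "A \<subseteq> {..<n}" "B \<subseteq> {..<n}"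
    "(card A = k+1 \<and> card B = k+2) \<or> (card A = k+2 \<and> card B = k+1)" "A \<times> B \<subseteq> insert (u, v) E"
    unfolding contains_Kst_def by blast
  have "\<not> A \<times> B \<subseteq> E" using AB(1-3) not_contains unfolding contains_Kst_def by blast
  then have uv: "u \<in> A" "v \<in> B" using AB(4) by auto
  have fin: "finite A" "finite B" using AB(1,2) by (simp_all add: finite_subset)
  show thesis
  proof (rule that)
    show "A - {u} \<subseteq> M v" "B - {v} \<subseteq> N u" "(A - {u}) \<times> (B - {v}) \<subseteq> E" using AB(4) uv by auto
    show "card (A - {u}) = k \<and> card (B - {v}) = k + 1 \<or> card (A - {u}) = k + 1 \<and> card (B - {v}) = k"
      using AB(3) uv fin by auto
  qed
qed

section \<open>Degree sums, full vertices and vertices of degree \<open>k\<close>\<close>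

lemma card_E_left: "card E = (\<Sum>u<n. card (N u))"
proof -
  have "E \<inter> {..<n} \<times> {..<n} = E" using subset by blast
  then have "card E = edges E {..<n} {..<n}" by (simp add: edges_def)
  then show ?thesis using N_subset by (simp add: edges_left Int_absorb2)
qed

lemma card_E_right: "card E = (\<Sum>v<n. card (M v))"
  using saturated.card_E_left[OF conv] by (simp add: card_E_conv)

lemma min_degree:
  assumes "u < n" "k \<le> n" shows "k \<le> card (N u)"
proof (cases "N u = {..<n}")
  case False
  then obtain v where "v < n" "(u, v) \<notin> E" using N_subset[of u] by auto
  then obtain A :: "nat set" and B where "B \<subseteq> N u" "card A = k \<and> card B = k + 1 \<or> card A = k + 1 \<and> card B = k"
    by (rule missing[OF assms(1)]) blast
  then show ?thesis using card_mono[of "N u" B] by auto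
qed (use assms in simp)

lemma good_if_full:
  assumes S: "S \<subseteq> {..<n}" "card S = k" "\<And>u. u \<in> S \<Longrightarrow> N u = {..<n}"
    and deg: "\<And>u. u < n \<Longrightarrow> k + 1 \<le> card (N u)"
  shows good
proof -
  let ?T = "{..<n} - S"
  have cT: "card ?T = n - k" and kn: "k \<le> n"
    using S card_mono[OF finite_lessThan S(1)] by (auto simp: card_Diff_subset finite_subset)
  have "card E = (\<Sum>u\<in>S. card (N u)) + (\<Sum>u\<in>?T. card (N u))"
    unfolding card_E_left using sum.subset_diff[OF S(1) finite_lessThan] by (simp add: add.commute)
  also have "(\<Sum>u\<in>S. card (N u)) = k * n" using S by simp
  finally have E: "card E = k * n + (\<Sum>u\<in>?T. card (N u))" .
  have "(\<Sum>u\<in>?T. card (N u)) = (\<Sum>u\<in>?T. k + 1 + (card (N u) - (k + 1)))"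
    using deg by (intro sum.cong refl le_add_diff_inverse[symmetric]) auto
  also have "\<dots> = (n - k) * (k + 1) + (\<Sum>u\<in>?T. card (N u) - (k + 1))"
    using cT by (simp only: sum.distrib sum_constant of_nat_id add_mult_distrib2)
  finally have E': "card E = k * n + (n - k) * (k + 1) + (\<Sum>u\<in>?T. card (N u) - (k + 1))" using E by simp
  have calc: "k * n + (n - k) * (k + 1) + k * (k + 1) = (2 * k + 1) * n"
  proof -
    obtain m where "n = k + m" using kn le_Suc_ex by blast
    then show ?thesis by (simp add: algebra_simps)
  qed
  have "family_F n (k + 1) (k + 2) E" if "card E + k * (k + 1) = (2 * k + 1) * n"
  proof -
    have "(\<Sum>u\<in>?T. card (N u) - (k + 1)) = 0" using that E' calc by linarith
    then have "card (N u) = k + 1" if "u < n" "u \<notin> S" for u using that deg[of u] by (simp add: le_antisym)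
    then have "S \<subseteq> {..<n} \<and> card S = k + 1 - 1 \<and> (\<forall>u\<in>S. \<forall>v<n. (u, v) \<in> E) \<and>
        (\<forall>u<n. u \<notin> S \<longrightarrow> card {v. (u, v) \<in> E} = k + 2 - 1)"
      using S by (auto simp: Image_singleton)
    then show ?thesis using bip_graph not_contains unfolding family_F_def by blast
  qed
  then show ?thesis unfolding good_def using E' calc by linarith
qed

lemma good_if_full_right:
  assumes "S \<subseteq> {..<n}" "card S = k" "\<And>v. v \<in> S \<Longrightarrow> M v = {..<n}"
    and "\<And>v. v < n \<Longrightarrow> k + 1 \<le> card (M v)"
  shows good
  using saturated.good_if_full[OF conv, of S] assms good_conv by simp

text \<open>A copy forced at a non-neighbour \<open>v\<close> of \<open>u0\<close> has at most
  \<open>k\<close> vertices in \<open>N u0\<close>, hence all of \<open>N u0\<close>, so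
  \<open>v\<close> has \<open>k + 1\<close> neighbours dominating \<open>u0\<close>. In the equality
  case \<open>N u0\<close> turns out to be the set of full vertices.\<close>

lemma good_if_degree_k:
  assumes u0: "u0 < n" "card (N u0) = k" and n: "2 * k + 1 < n"
  shows good
proof -
  \<comment> \<open>A function of the vertex, because the equality case compares two vertices of
    degree \<open>k\<close>.\<close>
  define A where "A u0 = {u. u < n \<and> N u0 \<subseteq> N u}" for u0
  have finA [simp]: "finite (A u)" for u by (simp add: A_def)
  have deg: "k + 1 \<le> card (M v \<inter> A u0)" if u0: "u0 < n" "card (N u0) = k" and v: "v < n" "v \<notin> N u0" for u0 v
  proof -
    have "(u0, v) \<notin> E" using v by auto
    then obtain X Y where XY: "X \<subseteq> M v" "Y \<subseteq> N u0" "X \<times> Y \<subseteq> E"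
      "card X = k \<and> card Y = k + 1 \<or> card X = k + 1 \<and> card Y = k"
      using missing[OF u0(1) v(1)] by blast
    have "card Y \<le> k" using XY(2) u0(2) card_mono[of "N u0" Y] by simp
    then have c: "card X = k + 1" "card Y = k" using XY(4) by auto
    have "Y = N u0" using XY(2) c(2) u0(2) by (simp add: card_subset_eq)
    then have "X \<subseteq> M v \<inter> A u0" using XY(1,3) M_subset[of v] unfolding A_def by auto
    from card_mono[OF _ this] show ?thesis using c by simp
  qed
  have deg0: "k \<le> card (N u)" if "u < n" for u using min_degree[OF that] n by simp
  \<comment> \<open>A vertex of \<open>A u0\<close> sends exactly \<open>k\<close> edges to
    \<open>N u0\<close>; its other edges are counted from their right ends.\<close>
  have count: "card E = k * n + (\<Sum>u | u < n \<and> u \<notin> A u0. card (N u) - k)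
      + (\<Sum>v | v < n \<and> v \<notin> N u0. card (M v \<inter> A u0))" if u0: "u0 < n" "card (N u0) = k" for u0
  proof -
    let ?T = "{u. u < n \<and> u \<notin> A u0}" and ?V = "{v. v < n \<and> v \<notin> N u0}"
    have U: "{..<n} = A u0 \<union> ?T" "A u0 \<inter> ?T = {}" unfolding A_def by auto
    have cU: "card (A u0) + card ?T = n" using U(2) card_Un_disjoint[of "A u0" ?T] U(1)
      by (metis card_lessThan finA finite_Un finite_lessThan)
    have "card E = (\<Sum>u\<in>A u0. card (N u)) + (\<Sum>u\<in>?T. card (N u))"
      unfolding card_E_left by (subst U(1), rule sum.union_disjoint) (use U(2) in auto)
    also have "(\<Sum>u\<in>A u0. card (N u)) = (\<Sum>u\<in>A u0. k + card (N u \<inter> ?V))"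
    proof (rule sum.cong)
      fix u assume "u \<in> A u0"
      then have "N u = N u0 \<union> (N u \<inter> ?V)" using N_subset[of u] unfolding A_def by auto
      then have "card (N u) = card (N u0 \<union> (N u \<inter> ?V))" by simp
      also have "\<dots> = k + card (N u \<inter> ?V)" by (subst card_Un_disjoint) (use u0(2) in auto)
      finally show "card (N u) = k + card (N u \<inter> ?V)" .
    qed simp
    also have "\<dots> = k * card (A u0) + edges E (A u0) ?V" by (simp add: sum.distrib edges_left)
    also have "edges E (A u0) ?V = (\<Sum>v\<in>?V. card (M v \<inter> A u0))" by (simp add: edges_right)
    also have "(\<Sum>u\<in>?T. card (N u)) = (\<Sum>u\<in>?T. k + (card (N u) - k))"
      using deg0 by (intro sum.cong refl le_add_diff_inverse[symmetric]) auto
    also have "\<dots> = k * card ?T + (\<Sum>u\<in>?T. card (N u) - k)" by (simp add: sum.distrib)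
    finally have "card E = k * card (A u0) + k * card ?T + (\<Sum>u\<in>?T. card (N u) - k)
      + (\<Sum>v\<in>?V. card (M v \<inter> A u0))" by simp
    moreover have "k * card (A u0) + k * card ?T = k * n" using cU by (metis add_mult_distrib2)
    ultimately show ?thesis by simp
  qed
  have cV: "card {v. v < n \<and> v \<notin> N u0} = n - k" if "card (N u0) = k" for u0
  proof -
    have "{v. v < n \<and> v \<notin> N u0} = {..<n} - N u0" by auto
    then show ?thesis using that N_subset[of u0] by (simp add: card_Diff_subset)
  qed
  have split: "card E + k * (k + 1) = (2 * k + 1) * n + (\<Sum>u | u < n \<and> u \<notin> A u0. card (N u) - k)
      + (\<Sum>v | v < n \<and> v \<notin> N u0. card (M v \<inter> A u0) - (k + 1))" if u0: "u0 < n" "card (N u0) = k" for u0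
  proof -
    let ?V = "{v. v < n \<and> v \<notin> N u0}"
    have "(\<Sum>v\<in>?V. card (M v \<inter> A u0)) = (\<Sum>v\<in>?V. (k + 1) + (card (M v \<inter> A u0) - (k + 1)))"
      using deg[OF u0] by (intro sum.cong refl le_add_diff_inverse[symmetric]) auto
    also have "\<dots> = (n - k) * (k + 1) + (\<Sum>v\<in>?V. card (M v \<inter> A u0) - (k + 1))"
      using cV[OF u0(2)] by (simp only: sum.distrib sum_constant of_nat_id add_mult_distrib2)
    finally have "card E = k * n + (\<Sum>u | u < n \<and> u \<notin> A u0. card (N u) - k) + ((n - k) * (k + 1)
      + (\<Sum>v\<in>?V. card (M v \<inter> A u0) - (k + 1)))" using count[OF u0] by simp
    moreover have "k * n + (n - k) * (k + 1) + k * (k + 1) = (2 * k + 1) * n"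
    proof -
      obtain m where "n = k + m" using n le_Suc_ex[of k n] by auto
      then show ?thesis by (simp add: algebra_simps)
    qed
    ultimately show ?thesis by linarith
  qed
  have "family_F n (k + 1) (k + 2) E" if eq: "card E + k * (k + 1) = (2 * k + 1) * n"
  proof -
    have outer: "card (N u) = k" if "u0 < n" "card (N u0) = k" "u < n" "u \<notin> A u0" for u0 u
    proof -
      have "(\<Sum>u | u < n \<and> u \<notin> A u0. card (N u) - k) = 0" using split[OF that(1,2)] eq by linarith
      then show ?thesis using that(3,4) deg0[of u] by (simp add: le_antisym)
    qed
    have inner: "card (M v \<inter> A u0) = k + 1" if "u0 < n" "card (N u0) = k" "v < n" "v \<notin> N u0" for u0 v
    proof -
      have "(\<Sum>v | v < n \<and> v \<notin> N u0. card (M v \<inter> A u0) - (k + 1)) = 0"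
        using split[OF that(1,2)] eq by linarith
      then show ?thesis using that(3,4) deg[OF that] by (simp add: le_antisym)
    qed
    \<comment> \<open>Otherwise some \<open>u1\<close> outside also has degree \<open>k\<close>.
      Vertices of degree above \<open>k\<close> dominate both \<open>u0\<close> and
      \<open>u1\<close>, so there are at most \<open>k + 1\<close> of them. Yet each
      \<open>v\<close> outside \<open>N u0\<close> needs \<open>k + 1\<close> such neighbours, so
      they are complete to \<open>n - k > k + 1\<close> vertices.\<close>
    have all: "A u0 = {..<n}"
    proof (rule ccontr)
      assume "A u0 \<noteq> {..<n}"
      then obtain u1 where u1: "u1 < n" "u1 \<notin> A u0" unfolding A_def by auto
      have k1: "card (N u1) = k" using outer u0 u1 by blast
      define D where "D = {u. u < n \<and> k < card (N u)}"
      have "\<not> N u0 \<subseteq> N u1" using u1 unfolding A_def by auto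
      then have "card (N u1) < card (N u0 \<union> N u1)" by (intro psubset_card_mono) auto
      then obtain R where R: "R \<subseteq> N u0 \<union> N u1" "card R = k + 1"
        using ex_subset_card[of "N u0 \<union> N u1" "k + 1"] k1 by auto
      have "D \<subseteq> A u0" "D \<subseteq> A u1" using outer[OF u0] outer[OF u1(1) k1] unfolding D_def by fastforce+
      then have "D \<times> R \<subseteq> E" using R(1) unfolding A_def by blast
      from free_left[OF R(2) this] have cD: "card D \<le> k + 1" .
      have full: "M v \<inter> A u0 = D" if v: "v < n" "v \<notin> N u0" for v
      proof (rule card_seteq)
        show "finite D" unfolding D_def by simp
        show "card D \<le> card (M v \<inter> A u0)" using inner[OF u0 v] cD by simp
        show "M v \<inter> A u0 \<subseteq> D"
        proof
          fix u assume u: "u \<in> M v \<inter> A u0"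
          then have "insert v (N u0) \<subseteq> N u" unfolding A_def by auto
          from card_mono[OF _ this] show "u \<in> D" using u0 v u unfolding D_def A_def by auto
        qed
      qed
      obtain v where v: "v < n" "v \<notin> N u0"
      proof -
        have "card {v. v < n \<and> v \<notin> N u0} \<noteq> 0" using cV[OF u0(2)] n by simp
        then have "{v. v < n \<and> v \<notin> N u0} \<noteq> {}" by (metis card.empty)
        then show ?thesis using that by blast
      qed
      have "card D = k + 1" using inner[OF u0 v] full[OF v] by simp
      moreover have "D \<times> {v. v < n \<and> v \<notin> N u0} \<subseteq> E" using full by blast
      ultimately have "n - k \<le> k + 1" using free_right cV[OF u0(2)] by metis
      then show False using n by simp
    qed
    have "card {u. (u, v) \<in> E} = k + 1" if "v < n" "v \<notin> N u0" for v
    proof -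
      have "{u. (u, v) \<in> E} = M v \<inter> A u0" using all edge_lt by auto
      then show ?thesis using inner[OF u0 that] by simp
    qed
    moreover have "\<forall>v\<in>N u0. \<forall>u<n. (u, v) \<in> E" using all unfolding A_def by auto
    ultimately have "N u0 \<subseteq> {..<n} \<and> card (N u0) = k + 1 - 1 \<and> (\<forall>v\<in>N u0. \<forall>u<n. (u, v) \<in> E) \<and>
        (\<forall>v<n. v \<notin> N u0 \<longrightarrow> card {u. (u, v) \<in> E} = k + 2 - 1)"
      using u0 N_subset by simp
    then show ?thesis using bip_graph not_contains unfolding family_F_def by blast
  qed
  then show ?thesis unfolding good_def using split[OF u0] by linarith
qed

end

section \<open>Tight edges\<close>

locale tight_edge = saturated +
  fixes z1 y1 :: nat
  assumes edge: "(z1, y1) \<in> E"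
    and deg_z1: "card (N z1) = k + 1" and deg_y1: "card (M y1) = k + 1"
    and complete: "(M y1 - {z1}) \<times> (N z1 - {y1}) \<subseteq> E"
    and min_N: "u < n \<Longrightarrow> k + 1 \<le> card (N u)" and min_M: "v < n \<Longrightarrow> k + 1 \<le> card (M v)"
begin

lemma tight_edge_conv: "tight_edge n k (E\<inverse>) y1 z1"
proof -
  interpret conv: saturated n k "E\<inverse>" by (rule conv)
  show ?thesis using edge deg_z1 deg_y1 complete min_N min_M by unfold_locales auto
qed

definition S where "S = M y1 - {z1}"
definition Q where "Q = N z1 - {y1}"
definition W where "W = {u. u < n \<and> u \<notin> S \<and> \<not> Q \<subseteq> N u}"
definition Z where "Z = {u. u < n \<and> u \<notin> S \<and> Q \<subseteq> N u}"
definition W' where "W' = {v. v < n \<and> v \<notin> Q \<and> \<not> S \<subseteq> M v}"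
definition Z' where "Z' = {v. v < n \<and> v \<notin> Q \<and> S \<subseteq> M v}"
text \<open>Since \<open>card Q = k\<close>, this is the number of non-neighbours in
  \<open>Q\<close>.\<close>

definition defect where "defect u = k - card (N u \<inter> Q)"
definition defect' where "defect' v = k - card (M v \<inter> S)"
text \<open>A charging condition: if \<open>w\<close> gives \<open>1 / (defect' w + 1)\<close> to
  each neighbour in \<open>Z\<close>, then at least \<open>a\<close> vertices give \<open>z\<close>
  at least \<open>1 / a\<close> each.\<close>

definition paid where "paid z \<longleftrightarrow> (\<exists>a>0. a \<le> card {w \<in> N z \<inter> W'. defect' w < a})"
definition paid' where "paid' y \<longleftrightarrow> (\<exists>a>0. a \<le> card {w \<in> M y \<inter> W. defect w < a})"
text \<open>These lack the edge into \<open>Z'\<close> that every other vertex of \<open>Z\<close>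
  contributes, and must be compensated by edges from \<open>Z\<close> to \<open>W'\<close>.\<close>

definition L where "L = {z \<in> Z. N z \<inter> Z' = {}}"
definition L' where "L' = {y \<in> Z'. M y \<inter> Z = {}}"

interpretation dual: tight_edge n k "E\<inverse>" y1 z1 by (rule tight_edge_conv)

text \<open>Exchanging the classes swaps primed and unprimed notions, so the lemmas below also hold
  in mirrored form.\<close>

lemma dual_simps [simp]:
  "dual.S = Q" "dual.Q = S" "dual.W = W'" "dual.W' = W" "dual.Z = Z'" "dual.Z' = Z"
  "dual.defect = defect'" "dual.defect' = defect" "dual.paid = paid'" "dual.paid' = paid"
  "dual.L = L'" "dual.L' = L"
  unfolding dual.S_def dual.Q_def dual.W_def dual.W'_def dual.Z_def dual.Z'_def dual.defect_def
    dual.defect'_def dual.paid_def dual.paid'_def dual.L_def dual.L'_def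
    S_def Q_def W_def W'_def Z_def Z'_def defect_def defect'_def paid_def paid'_def L_def L'_def fun_eq_iff
  by (simp_all only: converse_converse simp_thms)

section \<open>Forced copies around a tight edge\<close>

lemma finite_sets [simp]: "finite S" "finite Q" "finite W" "finite W'" "finite Z" "finite Z'" "finite L" "finite L'"
  by (simp_all add: S_def Q_def W_def W'_def Z_def Z'_def L_def L'_def)

lemma S_props: "card S = k" "S \<subseteq> {..<n}" "S \<times> Q \<subseteq> E" "z1 \<notin> S" "M y1 = insert z1 S"
  using edge deg_y1 complete M_subset[of y1] by (auto simp: S_def Q_def)

lemma Q_props: "card Q = k" "Q \<subseteq> {..<n}" "y1 \<notin> Q" "N z1 = insert y1 Q"
  using tight_edge.S_props[OF tight_edge_conv] by simp_all

text \<open>Saturation at the non-edge \<open>(z1, w)\<close>: if the right side contained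
  \<open>y1\<close>, the left side would be \<open>S\<close>, although \<open>w\<close> is not
  complete to \<open>S\<close>. So the right side is \<open>Q\<close>, and the vertices of the left
  side outside \<open>S\<close> lie in \<open>Z\<close>.\<close>

lemma many_Z:
  assumes w: "w \<in> W'"
  shows "defect' w + 1 \<le> card (M w \<inter> Z)"
proof -
  have w': "w < n" "w \<notin> Q" "\<not> S \<subseteq> M w" using w by (auto simp: W'_def)
  have "w \<noteq> y1" using w'(3) S_props(5) by auto
  then have "w \<notin> N z1" using w'(2) Q_props(4) by auto
  then have nz: "(z1, w) \<notin> E" by simp
  then obtain A B where AB: "A \<subseteq> M w" "B \<subseteq> N z1" "A \<times> B \<subseteq> E"
    "card A = k \<and> card B = k + 1 \<or> card A = k + 1 \<and> card B = k"
    using missing[of z1 w] edge_lt(1)[OF edge] w'(1) by metis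
  have fin: "finite A" "finite B" using AB(1,2) finite_subset by (metis finite_M, metis finite_N)
  have "y1 \<notin> B"
  proof
    assume "y1 \<in> B"
    then have "A \<subseteq> M y1" using AB(3) by auto
    then have "A \<subseteq> S" using AB(1) nz S_props(5) by auto
    then have "A = S" using AB(4) S_props(1) card_mono[of S A]
      by (metis card_seteq finite_sets(1) le_add1 order_refl)
    then show False using AB(1) w'(3) by simp
  qed
  then have "B \<subseteq> Q" using AB(2) Q_props(4) by auto
  then have "card B \<le> k" using Q_props(1) card_mono[of Q B] by simp
  then have c: "card A = k + 1" "card B = k" using AB(4) by auto
  have "B = Q" using \<open>B \<subseteq> Q\<close> c(2) Q_props(1) by (simp add: card_subset_eq)
  then have "A - S \<subseteq> M w \<inter> Z" using AB(1,3) M_subset[of w] by (auto simp: Z_def)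
  then have 1: "card (A - S) \<le> card (M w \<inter> Z)" by (intro card_mono) auto
  have "card (A \<inter> S) \<le> card (M w \<inter> S)" using AB(1) by (intro card_mono) auto
  moreover have "card A = card (A \<inter> S) + card (A - S)" using fin(1) by (rule card_Int_Diff_split)
  moreover have "card (M w \<inter> S) \<le> k" using S_props(1) card_mono[of S "M w \<inter> S"] by simp
  ultimately show ?thesis using c(1) 1 unfolding defect'_def by linarith
qed

text \<open>In the copy forced at \<open>(z, y)\<close>, the vertices outside \<open>S\<close> and
  \<open>Q\<close> lie in \<open>W\<close> and \<open>W'\<close>. Their defects are at most what the
  copy leaves uncovered of \<open>Q\<close> and \<open>S\<close>, so the larger of the two groups
  pays for an endpoint.\<close>

lemma missing_pair:
  assumes z: "z \<in> L" and y: "y \<in> L'"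
  shows "(paid z \<or> paid' y) \<and> edges E W W' > 0"
proof -
  have z': "z < n" "z \<notin> S" "Q \<subseteq> N z" "N z \<inter> Z' = {}" using z by (auto simp: L_def Z_def)
  have y': "y < n" "y \<notin> Q" "S \<subseteq> M y" "M y \<inter> Z = {}" "y \<in> Z'" using y by (auto simp: L'_def Z'_def)
  have "(z, y) \<notin> E" using z' y' by auto
  then obtain A B where AB: "A \<subseteq> M y" "B \<subseteq> N z" "A \<times> B \<subseteq> E"
    "card A = k \<and> card B = k + 1 \<or> card A = k + 1 \<and> card B = k"
    using missing[of z y] z'(1) y'(1) by metis
  have fin: "finite A" "finite B" using AB(1,2) finite_subset by (metis finite_M, metis finite_N)
  define a where "a = card (A - S)"
  define b where "b = card (B - Q)"
  have AW: "A - S \<subseteq> M y \<inter> W" using AB(1) y'(4) M_subset[of y] by (auto simp: Z_def W_def)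
  have BW: "B - Q \<subseteq> N z \<inter> W'" using AB(2) z'(4) N_subset[of z] by (auto simp: Z'_def W'_def)
  have cA: "card A = card (A \<inter> S) + a" unfolding a_def using fin(1) by (rule card_Int_Diff_split)
  have cB: "card B = card (B \<inter> Q) + b" unfolding b_def using fin(2) by (rule card_Int_Diff_split)
  have cAS: "card (A \<inter> S) \<le> k" using S_props(1) card_mono[of S "A \<inter> S"] by simp
  have cBQ: "card (B \<inter> Q) \<le> k" using Q_props(1) card_mono[of Q "B \<inter> Q"] by simp
  have dA: "defect u \<le> k - card (B \<inter> Q)" if "u \<in> A" for u
  proof -
    have "B \<inter> Q \<subseteq> N u \<inter> Q" using AB(3) that by auto
    from card_mono[OF _ this] show ?thesis by (simp add: defect_def)
  qed
  have dB: "defect' v \<le> k - card (A \<inter> S)" if "v \<in> B" for v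
  proof -
    have "A \<inter> S \<subseteq> M v \<inter> S" using AB(3) that by auto
    from card_mono[OF _ this] show ?thesis by (simp add: defect'_def)
  qed
  have posW: "defect u > 0" if "u \<in> W" for u
  proof -
    have "N u \<inter> Q \<subset> Q" using that by (auto simp: W_def)
    from psubset_card_mono[OF _ this] show ?thesis using Q_props(1) by (simp add: defect_def)
  qed
  have posW': "defect' u > 0" if "u \<in> W'" for u
  proof -
    have "M u \<inter> S \<subset> S" using that by (auto simp: W'_def)
    from psubset_card_mono[OF _ this] show ?thesis using S_props(1) by (simp add: defect'_def)
  qed
  \<comment> \<open>A vertex of \<open>W\<close> in the copy has positive defect, so the copy omits
    part of \<open>Q\<close> and needs a vertex outside \<open>Q\<close>; likewise on the other
    side.\<close>
  have ab: "a > 0 \<longleftrightarrow> b > 0"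
  proof
    assume "a > 0"
    then obtain u where u: "u \<in> A - S" unfolding a_def by (metis card_gt_0_iff ex_in_conv)
    then have "defect u > 0" using AW posW by auto
    then have "card (B \<inter> Q) < k" using dA[of u] u by auto
    then show "b > 0" using cB AB(4) by auto
  next
    assume "b > 0"
    then obtain u where u: "u \<in> B - Q" unfolding b_def by (metis card_gt_0_iff ex_in_conv)
    then have "defect' u > 0" using BW posW' by auto
    then have "card (A \<inter> S) < k" using dB[of u] u by auto
    then show "a > 0" using cA AB(4) by auto
  qed
  have "a > 0 \<or> b > 0" using cA cB AB(4) cAS cBQ by linarith
  then have pos: "a > 0" "b > 0" using ab by auto
  have py: "paid' y" if "c > 0" "c \<le> a" "k - card (B \<inter> Q) < c" for c
  proof -
    have "A - S \<subseteq> {w \<in> M y \<inter> W. defect w < c}" using AW dA that(3) by fastforce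
    from card_mono[OF _ this] have "c \<le> card {w \<in> M y \<inter> W. defect w < c}" using that(2) by (simp add: a_def)
    then show ?thesis using that(1) unfolding paid'_def by blast
  qed
  have pz: "paid z" if "c > 0" "c \<le> b" "k - card (A \<inter> S) < c" for c
  proof -
    have "B - Q \<subseteq> {w \<in> N z \<inter> W'. defect' w < c}" using BW dB that(3) by fastforce
    from card_mono[OF _ this] have "c \<le> card {w \<in> N z \<inter> W'. defect' w < c}" using that(2) by (simp add: b_def)
    then show ?thesis using that(1) unfolding paid_def by blast
  qed
  \<comment> \<open>The defect bounds \<open>k - card (B \<inter> Q)\<close> and
    \<open>k - card (A \<inter> S)\<close> are \<open>b - 1\<close> and \<open>a\<close>, or
    \<open>b\<close> and \<open>a - 1\<close>, depending on which side has \<open>k + 1\<close>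
    vertices.\<close>
  have "paid z \<or> paid' y"
  proof (cases "card A = k \<and> card B = k + 1")
    case True
    then have "k - card (B \<inter> Q) < b" "k - card (A \<inter> S) < a + 1" using cA cB cAS cBQ pos by linarith+
    then show ?thesis using py[of b] pz[of "a + 1"] pos by (cases "b \<le> a") auto
  next
    case False
    then have "card A = k + 1" "card B = k" using AB(4) by auto
    then have "k - card (B \<inter> Q) < b + 1" "k - card (A \<inter> S) < a" using cA cB cAS cBQ pos by linarith+
    then show ?thesis using py[of "b + 1"] pz[of a] pos by (cases "a \<le> b") auto
  qed
  moreover obtain u v where "u \<in> A - S" "v \<in> B - Q"
    using pos unfolding a_def b_def by (metis card_gt_0_iff ex_in_conv)
  then have "edges E W W' > 0" using AW BW AB(3) by (intro edges_pos[of _ _ u v]) auto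
  ultimately show ?thesis by simp
qed

text \<open>Every \<open>w \<in> W'\<close> has a surplus of at least \<open>1 / (defect' w + 1)\<close> per incident edge from \<open>Z\<close>;
  a paid vertex of \<open>L\<close> collects at least 1 from these surpluses.\<close>

lemma paid_count:
  assumes "\<And>z. z \<in> L \<Longrightarrow> paid z"
  shows "card L + (\<Sum>w\<in>W'. defect' w) \<le> edges E Z W'"
proof -
  define f where "f w = 1 / (real (defect' w) + 1)" for w
  have surplus: "real (card (M w \<inter> Z)) * f w \<le> real (card (M w \<inter> Z)) - real (defect' w)" if "w \<in> W'" for w
  proof -
    define c d where "c = real (card (M w \<inter> Z))" and "d = real (defect' w)"
    have "c \<ge> d + 1" "d \<ge> 0" using many_Z[OF that] unfolding c_def d_def by linarith+
    then have "d * (c - d - 1) \<ge> 0" by simp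
    then have "c \<le> (c - d) * (d + 1)" by (simp add: algebra_simps)
    then show ?thesis using \<open>d \<ge> 0\<close> unfolding f_def c_def[symmetric] d_def[symmetric] by (simp add: divide_le_eq)
  qed
  have collect: "1 \<le> (\<Sum>w\<in>N z \<inter> W'. f w)" if "z \<in> L" for z
  proof -
    obtain a where a: "a > 0" "a \<le> card {w \<in> N z \<inter> W'. defect' w < a}"
      using assms[OF \<open>z \<in> L\<close>] unfolding paid_def by blast
    let ?C = "{w \<in> N z \<inter> W'. defect' w < a}"
    have "1 \<le> real (card ?C) * (1 / real a)" using a by (simp add: divide_simps)
    also have "\<dots> = (\<Sum>w\<in>?C. 1 / real a)" by simp
    also have "\<dots> \<le> (\<Sum>w\<in>?C. f w)"
      using a(1) by (intro sum_mono) (auto simp: f_def divide_simps)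
    also have "\<dots> \<le> (\<Sum>w\<in>N z \<inter> W'. f w)" by (intro sum_mono2) (auto simp: f_def)
    finally show ?thesis .
  qed
  have LZ: "L \<subseteq> Z" by (auto simp: L_def)
  have "real (card L) \<le> (\<Sum>z\<in>L. \<Sum>w\<in>N z \<inter> W'. f w)" using sum_mono[of L "\<lambda>_. 1" "\<lambda>z. \<Sum>w\<in>N z \<inter> W'. f w"] collect by simp
  also have "\<dots> \<le> (\<Sum>z\<in>Z. \<Sum>w\<in>N z \<inter> W'. f w)"
    using LZ by (intro sum_mono2) (auto intro!: sum_nonneg simp: f_def)
  also have "\<dots> = (\<Sum>z\<in>Z. \<Sum>w | w \<in> W' \<and> (z, w) \<in> E. f w)"
    by (intro sum.cong refl) auto
  also have "\<dots> = (\<Sum>w\<in>W'. \<Sum>z | z \<in> Z \<and> (z, w) \<in> E. f w)"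
    by (rule sum.swap_restrict) auto
  also have "\<dots> = (\<Sum>w\<in>W'. real (card (M w \<inter> Z)) * f w)"
  proof (intro sum.cong refl)
    fix w
    have "{z. z \<in> Z \<and> (z, w) \<in> E} = M w \<inter> Z" by auto
    then show "(\<Sum>z | z \<in> Z \<and> (z, w) \<in> E. f w) = real (card (M w \<inter> Z)) * f w" by simp
  qed
  also have "\<dots> \<le> (\<Sum>w\<in>W'. real (card (M w \<inter> Z)) - real (defect' w))"
    using surplus by (intro sum_mono) auto
  also have "\<dots> = real (edges E Z W') - real (\<Sum>w\<in>W'. defect' w)" by (simp add: edges_right sum_subtractf)
  finally show ?thesis by linarith
qed

text \<open>The count without charging: it gives strictness when \<open>L\<close> is empty, and its
  mirror image handles the edges from \<open>W\<close> to \<open>Z'\<close>.\<close>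

lemma edges_Z_W': "card W' + (\<Sum>w\<in>W'. defect' w) \<le> edges E Z W'"
proof -
  have "(\<Sum>w\<in>W'. defect' w + 1) \<le> edges E Z W'" unfolding edges_right[OF finite_sets(5,4)]
    using many_Z by (intro sum_mono) auto
  then show ?thesis by (simp only: sum.distrib sum_constant of_nat_id mult_1_right add.commute)
qed

lemma edges_Z_Z': "card Z \<le> edges E Z Z' + card L"
proof -
  have "card (Z - L) \<le> (\<Sum>z\<in>Z - L. card (N z \<inter> Z'))"
  proof -
    have "(\<Sum>z\<in>Z - L. 1) \<le> (\<Sum>z\<in>Z - L. card (N z \<inter> Z'))"
      by (intro sum_mono) (auto simp: L_def Suc_le_eq card_gt_0_iff)
    then show ?thesis by simp
  qed
  also have "\<dots> \<le> edges E Z Z'" unfolding edges_left[OF finite_sets(5,6)] by (intro sum_mono2) auto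
  finally show ?thesis using card_Diff_subset[of L Z] by (simp add: L_def)
qed

section \<open>The edge count around a tight edge\<close>

lemma Z_W_partition: "Z \<inter> W = {}" "Z \<union> W = {..<n} - S" "card Z + card W = n - k"
proof -
  show 1: "Z \<inter> W = {}" "Z \<union> W = {..<n} - S" unfolding Z_def W_def by auto
  then show "card Z + card W = n - k" using S_props
    by (metis card_Diff_subset card_Un_disjoint card_lessThan finite_sets(1,3,5))
qed

lemma k_le_n: "k \<le> n" using S_props(1,2) card_mono[of "{..<n}" S] by simp

lemma sum_defect: "edges E (Z \<union> W) Q + (\<Sum>w\<in>W. defect w) = k * (n - k)"
proof -
  have c: "card (N u \<inter> Q) \<le> k" for u using Q_props(1) card_mono[of Q "N u \<inter> Q"] by simp
  have "defect u = 0" if "u \<in> Z" for u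
  proof -
    have "N u \<inter> Q = Q" using that by (auto simp: Z_def)
    then show ?thesis using Q_props(1) by (simp add: defect_def)
  qed
  then have "(\<Sum>w\<in>W. defect w) = (\<Sum>w\<in>Z \<union> W. defect w)"
    by (intro sum.mono_neutral_left) auto
  then have "edges E (Z \<union> W) Q + (\<Sum>w\<in>W. defect w) = (\<Sum>u\<in>Z \<union> W. card (N u \<inter> Q) + defect u)"
    by (simp add: edges_left sum.distrib)
  also have "\<dots> = (\<Sum>u\<in>Z \<union> W. k)" using c by (intro sum.cong) (auto simp: defect_def)
  also have "\<dots> = k * (n - k)" using card_Un_disjoint[OF finite_sets(5,3) Z_W_partition(1)] Z_W_partition(3) by simp
  finally show ?thesis .
qed

lemma card_E_defect:
  "card E + (\<Sum>w\<in>W. defect w) + (\<Sum>w\<in>W'. defect' w) =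
    k * k + 2 * k * (n - k) + (edges E Z Z' + edges E Z W' + edges E W Z' + edges E W W')"
proof -
  have Un: "{..<n} = S \<union> (Z \<union> W)" "{..<n} = Q \<union> (Z' \<union> W')"
    using Z_W_partition(2) tight_edge.Z_W_partition(2)[OF tight_edge_conv] S_props(2) Q_props(2) by auto
  have disj: "S \<inter> (Z \<union> W) = {}" "Q \<inter> (Z' \<union> W') = {}" "Z \<inter> W = {}" "Z' \<inter> W' = {}"
    using Z_W_partition tight_edge.Z_W_partition[OF tight_edge_conv] by auto
  have "card E = edges E {..<n} {..<n}"
    unfolding edges_def using subset by (simp add: Int_absorb2)
  also have "\<dots> = edges E (S \<union> (Z \<union> W)) (Q \<union> (Z' \<union> W'))" using Un by simp
  also have "\<dots> = edges E S Q + edges E S (Z' \<union> W') + edges E (Z \<union> W) Q + edges E (Z \<union> W) (Z' \<union> W')"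
    using disj by (simp add: edges_Un_left edges_Un_right del: Un_assoc)
  also have "edges E S Q = k * k"
    using S_props Q_props by (simp add: edges_def Int_absorb1 card_cartesian_product)
  also have "edges E S (Z' \<union> W') = edges (E\<inverse>) (Z' \<union> W') S" by (simp only: edges_converse)
  also have "edges E (Z \<union> W) (Z' \<union> W') = edges E Z Z' + edges E Z W' + edges E W Z' + edges E W W'"
    using disj by (simp add: edges_Un_left edges_Un_right)
  finally show ?thesis using sum_defect tight_edge.sum_defect[OF tight_edge_conv] by simp
qed

text \<open>The edges between \<open>Z\<close> and \<open>Z'\<close>, \<open>Z\<close> and
  \<open>W'\<close>, \<open>W\<close> and \<open>Z'\<close> supply one edge per vertex of
  \<open>Z \<union> W\<close> and cancel all defects. The two extra terms on the left serve to show
  strictness.\<close>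

lemma lower_bound:
  assumes "\<And>z. z \<in> L \<Longrightarrow> paid z"
  shows "(2 * k + 1) * n + edges E W W' + (if L = {} then card W' else 0) \<le> card E + k * (k + 1)"
proof -
  have 1: "card L + (\<Sum>w\<in>W'. defect' w) + (if L = {} then card W' else 0) \<le> edges E Z W'"
    using paid_count assms edges_Z_W' by auto
  have 2: "card W + (\<Sum>w\<in>W. defect w) \<le> edges E W Z'"
    using tight_edge.edges_Z_W'[OF tight_edge_conv] by (simp add: edges_converse)
  have "card E + (\<Sum>w\<in>W. defect w) + (\<Sum>w\<in>W'. defect' w) \<ge>
    k * k + 2 * k * (n - k) + (card Z + (\<Sum>w\<in>W'. defect' w) + (if L = {} then card W' else 0)
    + (card W + (\<Sum>w\<in>W. defect w)) + edges E W W')"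
    using card_E_defect edges_Z_Z' 1 2 by linarith
  then have "card E \<ge> k * k + 2 * k * (n - k) + (n - k) + (if L = {} then card W' else 0) + edges E W W'"
    using Z_W_partition(3) by linarith
  moreover have "k * k + 2 * k * (n - k) + (n - k) + k * (k + 1) = (2 * k + 1) * n"
  proof -
    obtain m where "n = k + m" using k_le_n le_Suc_ex by blast
    then show ?thesis by (simp add: algebra_simps)
  qed
  ultimately show ?thesis by linarith
qed

lemma good_if_W_empty: "W = {} \<Longrightarrow> good"
proof (rule good_if_full_right[of Q])
  assume W: "W = {}"
  show "M v = {..<n}" if "v \<in> Q" for v
  proof -
    have "u \<in> M v" if "u < n" for u
      using \<open>v \<in> Q\<close> that W S_props(3) by (cases "u \<in> S") (auto simp: W_def)
    then show ?thesis using M_subset[of v] by blast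
  qed
qed (use Q_props min_M in auto)

text \<open>If \<open>W\<close> or \<open>W'\<close> is empty, \<open>Q\<close> or \<open>S\<close>
  consists of full vertices. Otherwise the bound is strict: through \<open>W'\<close> if
  \<open>L\<close> is empty, through \<open>W\<close> in the mirrored bound if \<open>L'\<close> is
  empty (its hypothesis is then vacuous), and through an edge between \<open>W\<close> and
  \<open>W'\<close> if neither is.\<close>

lemma good_if_all_paid:
  assumes "\<And>z. z \<in> L \<Longrightarrow> paid z"
  shows good
proof (cases "W = {} \<or> W' = {}")
  case True
  then show ?thesis using good_if_W_empty tight_edge.good_if_W_empty[OF tight_edge_conv] good_conv by auto
next
  case False
  have "(2 * k + 1) * n < card E + k * (k + 1)"
  proof (cases "L = {}")
    case True
    moreover have "card W' > 0" using False by (simp add: card_gt_0_iff)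
    ultimately show ?thesis using lower_bound[OF assms] by simp
  next
    case L: False
    show ?thesis
    proof (cases "L' = {}")
      case True
      moreover have "card W > 0" using False by (simp add: card_gt_0_iff)
      ultimately show ?thesis using tight_edge.lower_bound[OF tight_edge_conv] card_E_conv by simp
    next
      case False
      then have "edges E W W' > 0" using L missing_pair by auto
      then show ?thesis using lower_bound[OF assms] by linarith
    qed
  qed
  then show ?thesis unfolding good_def by simp
qed

text \<open>By \<open>missing_pair\<close>, one unpaid vertex of \<open>L\<close> forces all of
  \<open>L'\<close> to be paid.\<close>

lemma good_tight_edge: good
proof (cases "\<forall>z\<in>L. paid z")
  case True
  then show ?thesis using good_if_all_paid by blast
next
  case False
  then have "paid' y" if "y \<in> L'" for y using missing_pair that by blast
  then have "saturated.good n k (E\<inverse>)" using tight_edge.good_if_all_paid[OF tight_edge_conv] by simp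
  then show ?thesis by (simp only: good_conv)
qed

end

section \<open>Almost all degrees prescribed\<close>

text \<open>\<open>C1\<close> bounds the complement of \<open>G\<close>: \<open>C\<close>
  exceptional vertices, and the neighbours of at most \<open>C\<close> irregular vertices outside
  \<open>A\<close>. \<open>c\<close> covers the exceptions in each use of
  \<open>good_if_linked\<close>, whose final count contradicts \<open>large\<close>.\<close>

locale near_extremal = saturated +
  fixes A :: "nat set" and C C1 c :: nat
  assumes min_N: "u < n \<Longrightarrow> k + 1 \<le> card (N u)" and min_M: "v < n \<Longrightarrow> k + 1 \<le> card (M v)"
    and A: "A \<subseteq> {..<n}" "card A \<le> C"
    and irregular: "card {u. u < n \<and> card (N u) \<noteq> k + 1} \<le> C"
    and bounded: "u < n \<Longrightarrow> u \<notin> A \<Longrightarrow> card (N u) \<le> C"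
    and exceptional: "card {v. v < n \<and> card (M v \<inter> A) \<noteq> k} \<le> C"
    and C1: "C1 = C + C * C" and c: "c = C1 + 2 * C * (C + C1) + C + k + 2"
    and large: "(k + 2) * c < n"
begin

definition P where "P = {u. u < n \<and> u \<notin> A \<and> card (N u) = k + 1}"
definition G where "G = {v. v < n \<and> card (M v \<inter> A) = k \<and> M v - A \<subseteq> P}"
text \<open>If \<open>v\<close> has degree \<open>k + 1\<close>, then \<open>X\<close> is its whole
  neighbourhood and \<open>(x, v)\<close> is a tight edge. For \<open>v\<close> outside
  \<open>K\<close>, the inclusion in \<open>K\<close> makes \<open>v\<close> recoverable from
  \<open>x\<close>.\<close>

definition linked where "linked K v \<longleftrightarrow> (\<exists>x\<in>P. (x, v) \<in> E \<and> N x - {v} \<subseteq> K \<and>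
  (\<exists>X\<subseteq>M v. card X = k + 1 \<and> X \<times> (N x - {v}) \<subseteq> E))"
definition T where "T u = {u'. u' < n \<and> u' \<noteq> u \<and> N u \<subseteq> N u'}"

lemma finite_A [simp]: "finite A" using A(1) finite_subset by (metis finite_lessThan)

lemma finite_PGT [simp]: "finite P" "finite G" "finite (T u)" by (simp_all add: P_def G_def T_def)

lemma card_non_P: "card ({..<n} - P) \<le> 2 * C"
proof -
  have "{..<n} - P \<subseteq> A \<union> {u. u < n \<and> card (N u) \<noteq> k + 1}" by (auto simp: P_def)
  then have "card ({..<n} - P) \<le> card (A \<union> {u. u < n \<and> card (N u) \<noteq> k + 1})" by (intro card_mono) auto
  also have "\<dots> \<le> card A + card {u. u < n \<and> card (N u) \<noteq> k + 1}" by (rule card_Un_le)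
  finally show ?thesis using A(2) irregular by linarith
qed

lemma card_non_G: "card ({..<n} - G) \<le> C1"
proof -
  let ?I = "{u. u < n \<and> u \<notin> A \<and> card (N u) \<noteq> k + 1}" and ?X = "{v. v < n \<and> card (M v \<inter> A) \<noteq> k}"
  have "card ?I \<le> card {u. u < n \<and> card (N u) \<noteq> k + 1}" by (intro card_mono) auto
  then have I: "card ?I \<le> C" using irregular by linarith
  have "{..<n} - G \<subseteq> ?X \<union> (\<Union>u\<in>?I. N u)"
  proof
    fix v assume v: "v \<in> {..<n} - G"
    show "v \<in> ?X \<union> (\<Union>u\<in>?I. N u)"
    proof (cases "card (M v \<inter> A) = k")
      case True
      then obtain u where u: "(u, v) \<in> E" "u \<notin> A" "u \<notin> P" using v by (auto simp: G_def)
      then have "u \<in> ?I" using edge_lt(1)[OF u(1)] by (simp add: P_def)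
      then show ?thesis using u(1) by blast
    qed (use v in simp)
  qed
  then have "card ({..<n} - G) \<le> card (?X \<union> (\<Union>u\<in>?I. N u))" by (intro card_mono) auto
  also have "\<dots> \<le> card ?X + card (\<Union>u\<in>?I. N u)" by (rule card_Un_le)
  also have "card (\<Union>u\<in>?I. N u) \<le> (\<Sum>u\<in>?I. card (N u))" by (rule card_UN_le) simp
  also have "\<dots> \<le> (\<Sum>u\<in>?I. C)" using bounded by (intro sum_mono) auto
  also have "\<dots> \<le> C * C" using I by simp
  finally show ?thesis using exceptional C1 by simp
qed

lemma linked_mono: "linked K v \<Longrightarrow> K \<subseteq> K' \<Longrightarrow> linked K' v"
  unfolding linked_def by blast

text \<open>The neighbours \<open>x\<close> of linked vertices \<open>v\<close> are distinct, so they exhaust almost all of \<open>P\<close>;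
  hence some linked \<open>v\<close> has degree exactly \<open>k + 1\<close> and \<open>(x, v)\<close> is a tight edge.\<close>

lemma good_if_linked:
  assumes few: "card {v. v < n \<and> \<not> (v \<in> G \<and> v \<notin> K \<and> linked K v)} \<le> c"
  shows good
proof (rule ccontr)
  assume "\<not> good"
  define L where "L = {v. v < n \<and> v \<in> G \<and> v \<notin> K \<and> linked K v}"
  have "\<forall>v\<in>L. \<exists>x. x \<in> P \<and> (x, v) \<in> E \<and> N x - {v} \<subseteq> K \<and>
      (\<exists>X\<subseteq>M v. card X = k + 1 \<and> X \<times> (N x - {v}) \<subseteq> E)"
    unfolding L_def linked_def by blast
  then obtain x where x: "\<And>v. v \<in> L \<Longrightarrow> x v \<in> P \<and> (x v, v) \<in> E \<and> N (x v) - {v} \<subseteq> K \<and>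
      (\<exists>X\<subseteq>M v. card X = k + 1 \<and> X \<times> (N (x v) - {v}) \<subseteq> E)"
    using bchoice[of L] by metis
  have finL: "finite L" unfolding L_def by simp
  have "{v. v < n \<and> \<not> (v \<in> G \<and> v \<notin> K \<and> linked K v)} = {..<n} - L" unfolding L_def by auto
  moreover have "L \<subseteq> {..<n}" unfolding L_def by auto
  ultimately have cL: "n \<le> card L + c" using few card_Diff_subset[OF finL, of "{..<n}"] by simp
  have deg: "k + 2 \<le> card (M v)" if v: "v \<in> L" for v
  proof (rule ccontr)
    assume "\<not> k + 2 \<le> card (M v)"
    then have cM: "card (M v) = k + 1" using min_M[of v] v unfolding L_def by auto
    obtain X where X: "X \<subseteq> M v" "card X = k + 1" "X \<times> (N (x v) - {v}) \<subseteq> E" using x[OF v] by blast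
    have "X = M v" using X(1,2) cM by (simp add: card_subset_eq)
    then have "(M v - {x v}) \<times> (N (x v) - {v}) \<subseteq> E" using X(3) by blast
    moreover have "card (N (x v)) = k + 1" using x[OF v] by (simp add: P_def)
    ultimately have "tight_edge n k E (x v) v" using x[OF v] cM min_N min_M by unfold_locales auto
    then show False using tight_edge.good_tight_edge \<open>\<not> good\<close> by blast
  qed
  have inj: "inj_on x L"
  proof (rule inj_onI)
    fix v v' assume "v \<in> L" "v' \<in> L" "x v = x v'"
    then show "v = v'" using x[of v] x[of v'] by (auto simp: L_def)
  qed
  define R where "R = P - x ` L"
  have xL: "x ` L \<subseteq> P" using x by auto
  have "card P \<le> n" using card_mono[of "{..<n}" P] by (auto simp: P_def)
  then have cR: "card R \<le> c" using card_Diff_subset[OF _ xL] finL card_image[OF inj] cL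
    unfolding R_def by simp
  \<comment> \<open>Exactly \<open>k\<close> neighbours of \<open>v\<close> lie in \<open>A\<close>,
    so \<open>P\<close> contains a second one besides \<open>x v\<close>. It is no
    \<open>x v'\<close>, since \<open>N (x v') - {v'}\<close> lies in \<open>K\<close> and
    \<open>v\<close> does not.\<close>
  have "L \<subseteq> (\<Union>u\<in>R. N u)"
  proof
    fix v assume v: "v \<in> L"
    then have vG: "card (M v \<inter> A) = k" "M v - A \<subseteq> P" by (auto simp: L_def G_def)
    have "card (M v) = card (M v \<inter> A) + card (M v - A)" by (rule card_Int_Diff_split) simp
    then have "2 \<le> card (M v - A)" using deg[OF v] vG(1) by linarith
    then have "card (M v - A - {x v}) \<noteq> 0" by (simp add: card_Diff_singleton_if)
    then obtain u where u: "u \<in> M v - A" "u \<noteq> x v" by (metis Diff_iff card.empty ex_in_conv singletonI)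
    have "u \<notin> x ` L"
    proof
      assume "u \<in> x ` L"
      then obtain v' where v': "v' \<in> L" "u = x v'" by auto
      then have "v \<in> N (x v') - {v'}" using u by auto
      then show False using x[OF v'(1)] v by (auto simp: L_def)
    qed
    then show "v \<in> (\<Union>u\<in>R. N u)" using u(1) vG(2) unfolding R_def by blast
  qed
  then have "card L \<le> (\<Sum>u\<in>R. card (N u))" by (intro card_le_sum_cover) (auto simp: R_def)
  also have "\<dots> = (\<Sum>u\<in>R. k + 1)" by (intro sum.cong) (auto simp: R_def P_def)
  also have "\<dots> \<le> (k + 1) * c" using mult_le_mono2[OF cR, of "k + 1"] by (simp add: mult.commute)
  finally show False using cL large by simp
qed

lemma card_T_le: "u \<in> P \<Longrightarrow> card (T u) \<le> k"
proof -
  assume u: "u \<in> P"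
  have "insert u (T u) \<times> N u \<subseteq> E" by (auto simp: T_def)
  from free_left[OF _ this] have "card (insert u (T u)) \<le> k + 1" using u by (simp add: P_def)
  moreover have "u \<notin> T u" by (simp add: T_def)
  ultimately show ?thesis by simp
qed

text \<open>A copy with \<open>k + 1\<close> vertices on the right uses all of \<open>N u\<close>,
  so its \<open>k\<close> left vertices dominate \<open>u\<close> and by \<open>card_T_le\<close>
  exhaust \<open>T u\<close>.\<close>

lemma dichotomy:
  assumes u: "u \<in> P" and v: "v < n" "v \<notin> N u"
  shows "card (T u) = k \<and> T u \<subseteq> M v \<or>
    (\<exists>X Y. X \<subseteq> M v \<and> Y \<subseteq> N u \<and> card X = k + 1 \<and> card Y = k \<and> X \<times> Y \<subseteq> E)"
proof -
  have "u < n" "(u, v) \<notin> E" using u v by (auto simp: P_def)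
  then obtain X Y where XY: "X \<subseteq> M v" "Y \<subseteq> N u" "X \<times> Y \<subseteq> E"
    "card X = k \<and> card Y = k + 1 \<or> card X = k + 1 \<and> card Y = k"
    using missing v(1) by metis
  show ?thesis
  proof (cases "card X = k \<and> card Y = k + 1")
    case True
    then have "Y = N u" using XY(2) u by (simp add: P_def card_subset_eq)
    then have "X \<subseteq> T u" using XY(1,3) v M_subset[of v] by (auto simp: T_def)
    then have "X = T u" using card_T_le[OF u] True by (simp add: card_seteq)
    then show ?thesis using True XY(1) by simp
  next
    case False
    then show ?thesis using XY by blast
  qed
qed

text \<open>The \<open>k + 1\<close> vertices of \<open>X\<close> do not fit into the
  \<open>k\<close> neighbours of \<open>v\<close> in \<open>A\<close>, so one of them is some
  \<open>x\<close> in \<open>P\<close>; having degree \<open>k + 1\<close>, it sees only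
  \<open>v\<close> and \<open>Y\<close>.\<close>

lemma dichotomy_G:
  assumes u: "u \<in> P" and v: "v \<in> G" "v \<notin> N u"
  shows "card (T u) = k \<and> T u \<subseteq> M v \<or> linked (N u) v"
proof (cases "card (T u) = k \<and> T u \<subseteq> M v")
  case False
  have "v < n" using v by (simp add: G_def)
  then obtain X Y where XY: "X \<subseteq> M v" "Y \<subseteq> N u" "card X = k + 1" "card Y = k" "X \<times> Y \<subseteq> E"
    using dichotomy[OF u _ v(2)] False by blast
  have "\<not> X \<subseteq> M v \<inter> A"
  proof
    assume "X \<subseteq> M v \<inter> A"
    from card_mono[OF _ this] show False using XY(3) v(1) by (simp add: G_def)
  qed
  then obtain x where x: "x \<in> X" "x \<in> M v - A" using XY(1) by auto
  then have xP: "x \<in> P" using v(1) by (auto simp: G_def)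
  have "v \<notin> Y" using v(2) XY(2) by auto
  moreover have "finite Y" using XY(2) finite_subset finite_N by metis
  ultimately have "card (insert v Y) = k + 1" using XY(4) by simp
  moreover have "insert v Y \<subseteq> N x" using x XY(5) by auto
  ultimately have "insert v Y = N x" using xP by (simp add: P_def card_subset_eq)
  then have "N x - {v} = Y" using \<open>v \<notin> Y\<close> by auto
  then have "linked (N u) v" unfolding linked_def using xP x XY by (intro bexI[of _ x]) auto
  then show ?thesis ..
qed simp

lemma card_bad_le:
  "finite K \<Longrightarrow> (\<And>v. v \<in> G \<Longrightarrow> v \<notin> K \<Longrightarrow> linked K v) \<Longrightarrow>
    card {v. v < n \<and> \<not> (v \<in> G \<and> v \<notin> K \<and> linked K v)} \<le> C1 + card K"
proof -
  assume K: "finite K" "\<And>v. v \<in> G \<Longrightarrow> v \<notin> K \<Longrightarrow> linked K v"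
  have "{v. v < n \<and> \<not> (v \<in> G \<and> v \<notin> K \<and> linked K v)} \<subseteq> ({..<n} - G) \<union> K" using K(2) by auto
  then have "card {v. v < n \<and> \<not> (v \<in> G \<and> v \<notin> K \<and> linked K v)} \<le> card (({..<n} - G) \<union> K)"
    using K(1) by (intro card_mono) auto
  also have "\<dots> \<le> card ({..<n} - G) + card K" by (rule card_Un_le)
  finally show ?thesis using card_non_G by linarith
qed

text \<open>If no \<open>K = N u\<close> works, every \<open>T u\<close> is a \<open>k\<close>-set
  inside \<open>A\<close>. Either two of these sets differ, and a vertex of \<open>G\<close> can
  match only one of them, or all equal one set \<open>S\<close>; then \<open>S\<close> consists of
  full vertices or a non-edge at \<open>S\<close> produces linked vertices.\<close>

lemma good_near_extremal: good
proof (cases "\<exists>u\<in>P. card {v. v < n \<and> \<not> (v \<in> G \<and> v \<notin> N u \<and> linked (N u) v)} \<le> c")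
  case True
  then show ?thesis using good_if_linked by blast
next
  case few: False
  \<comment> \<open>More than \<open>C\<close> vertices of \<open>G\<close> avoid \<open>N u\<close>
    and are not linked, so all of them see \<open>T u\<close>; its members thus have degree above
    \<open>C\<close> and lie in \<open>A\<close>.\<close>
  have T: "card (T u) = k \<and> T u \<subseteq> A" if u: "u \<in> P" for u
  proof -
    define X where "X = {v \<in> G. v \<notin> N u \<and> \<not> linked (N u) v}"
    have finX: "finite X" unfolding X_def by simp
    have "{v. v < n \<and> \<not> (v \<in> G \<and> v \<notin> N u \<and> linked (N u) v)} \<subseteq> ({..<n} - G) \<union> N u \<union> X"
      unfolding X_def by auto
    then have "card {v. v < n \<and> \<not> (v \<in> G \<and> v \<notin> N u \<and> linked (N u) v)} \<le> card (({..<n} - G) \<union> N u \<union> X)"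
      using finX by (intro card_mono) auto
    also have "\<dots> \<le> card ({..<n} - G) + card (N u) + card X"
      using card_Un_le[of "({..<n} - G) \<union> N u" X] card_Un_le[of "{..<n} - G" "N u"] by linarith
    finally have "c < C1 + (k + 1) + card X" using few u card_non_G by (fastforce simp: P_def)
    then have cX: "C < card X" using c by simp
    have type: "card (T u) = k \<and> T u \<subseteq> M v" if "v \<in> X" for v
      using dichotomy_G[OF u, of v] that unfolding X_def by auto
    obtain v where "v \<in> X" using cX by (metis card.empty ex_in_conv not_less0)
    have "s \<in> A" if s: "s \<in> T u" for s
    proof (rule ccontr)
      assume "s \<notin> A"
      then have "card (N s) \<le> C" using bounded s by (simp add: T_def)
      moreover have "X \<subseteq> N s" using type s by auto
      then have "card X \<le> card (N s)" by (intro card_mono) auto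
      ultimately show False using cX by simp
    qed
    then show ?thesis using type[OF \<open>v \<in> X\<close>] by auto
  qed
  have TA: "M v \<inter> A = T u" if "u \<in> P" "v \<in> G" "T u \<subseteq> M v" for u v
  proof -
    have "T u \<subseteq> M v \<inter> A" using T that by auto
    then show ?thesis using T[OF that(1)] that(2) card_subset_eq[of "M v \<inter> A" "T u"] by (simp add: G_def)
  qed
  show good
  proof (cases "\<exists>u\<in>P. \<exists>v\<in>G. v \<notin> N u \<and> M v \<inter> A \<noteq> T u")
    case True
    then obtain u v where uv: "u \<in> P" "v \<in> G" "v \<notin> N u" "M v \<inter> A \<noteq> T u" by blast
    then have "linked (N u) v" using dichotomy_G TA by blast
    then obtain x where x: "x \<in> P" "(x, v) \<in> E" "N x - {v} \<subseteq> N u" unfolding linked_def by blast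
    have "T x \<subseteq> M v" using x(2) by (auto simp: T_def)
    then have Tx: "T x \<noteq> T u" using TA x(1) uv by blast
    \<comment> \<open>\<open>K\<close> contains \<open>N u\<close> and \<open>N x\<close>. The trace
      of \<open>v'\<close> on \<open>A\<close> differs from \<open>T u\<close> or from
      \<open>T x\<close>, and the dichotomy at \<open>u\<close> or \<open>x\<close> links
      \<open>v'\<close>.\<close>
    define K where "K = insert v (N u)"
    have "linked K v'" if v': "v' \<in> G" "v' \<notin> K" for v'
    proof (cases "M v' \<inter> A = T u")
      case True
      have NxK: "N x \<subseteq> K" using x(3) unfolding K_def by auto
      then have "v' \<notin> N x" using v' by auto
      moreover have "\<not> T x \<subseteq> M v'" using TA[OF x(1) v'(1)] True Tx by auto
      ultimately have "linked (N x) v'" using dichotomy_G[OF x(1) v'(1)] by blast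
      then show ?thesis using linked_mono NxK by blast
    next
      case False
      have "v' \<notin> N u" using v' unfolding K_def by auto
      moreover have "\<not> T u \<subseteq> M v'" using TA[OF uv(1) v'(1)] False by auto
      ultimately have "linked (N u) v'" using dichotomy_G[OF uv(1) v'(1)] by blast
      then show ?thesis using linked_mono unfolding K_def by blast
    qed
    then have "card {v. v < n \<and> \<not> (v \<in> G \<and> v \<notin> K \<and> linked K v)} \<le> C1 + card K"
      by (intro card_bad_le) (simp_all add: K_def)
    moreover have "card K \<le> k + 2" using uv(1,3) by (simp add: K_def P_def)
    ultimately have "card {v. v < n \<and> \<not> (v \<in> G \<and> v \<notin> K \<and> linked K v)} \<le> c"
      unfolding c by linarith
    then show ?thesis by (rule good_if_linked)
  next
    case False
    have MA: "M v \<inter> A = T u" if "u \<in> P" "v \<in> G" for u v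
    proof (cases "v \<in> N u")
      case True
      then have "T u \<subseteq> M v" by (auto simp: T_def)
      then show ?thesis using TA that by blast
    qed (use False that in blast)
    have c2: "2 * C < n" "C1 < n"
    proof -
      have "2 * C \<le> 2 * c" "C1 \<le> c" "2 * c \<le> (k + 2) * c" "c \<le> (k + 2) * c" using c by auto
      then show "2 * C < n" "C1 < n" using large by linarith+
    qed
    have "\<not> {..<n} \<subseteq> {..<n} - P" using c2(1) card_non_P card_mono[of "{..<n} - P" "{..<n}"] by auto
    then obtain u0 where u0: "u0 \<in> P" by auto
    have "\<not> {..<n} \<subseteq> {..<n} - G" using c2(2) card_non_G card_mono[of "{..<n} - G" "{..<n}"] by auto
    then obtain v0 where v0: "v0 \<in> G" by auto
    define S where "S = T u0"
    have TS: "T u = S" if "u \<in> P" for u using MA[OF that v0] MA[OF u0 v0] unfolding S_def by simp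
    have MS: "M v \<inter> A = S" if "v \<in> G" for v using MA[OF u0 that] unfolding S_def .
    have S: "S \<subseteq> {..<n}" "card S = k" "S \<subseteq> A" using T[OF u0] A(1) unfolding S_def by auto
    show ?thesis
    proof (cases "\<forall>s\<in>S. N s = {..<n}")
      case True
      then show ?thesis using good_if_full[OF S(1,2)] min_N by blast
    next
      case False
      then obtain s w where sw: "s \<in> S" "w < n" "(s, w) \<notin> E" using N_subset by blast
      have notw: "w \<notin> N u" if "u \<in> P" for u using sw TS[OF that] by (auto simp: T_def)
      \<comment> \<open>Since \<open>w\<close> has no neighbour in \<open>P\<close>, its neighbours
        outside \<open>S\<close> lie in \<open>I\<close>. Hence the copy forced at
        \<open>(u, w)\<close> puts \<open>k\<close> neighbours of \<open>u\<close> into the bounded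
        set \<open>K\<close>.\<close>
      define I where "I = {..<n} - P - S"
      define K where "K = (\<Union>e\<in>I. N e)"
      have cN: "card (N e) \<le> C + C1" if "e \<in> I" for e
      proof (cases "e \<in> A")
        case True
        \<comment> \<open>Vertices of \<open>G\<close> meet \<open>A\<close> exactly in
          \<open>S\<close>, and \<open>e\<close> is not in \<open>S\<close>.\<close>
        then have "N e \<subseteq> {..<n} - G" using that MS N_subset[of e] unfolding I_def by fastforce
        from card_mono[OF _ this] show ?thesis using card_non_G by simp
      next
        case False
        then show ?thesis using bounded[of e] that unfolding I_def by auto
      qed
      have "card I \<le> 2 * C" using card_non_P card_mono[of "{..<n} - P" I] unfolding I_def by auto
      have "card K \<le> (\<Sum>e\<in>I. card (N e))" unfolding K_def by (rule card_UN_le) (simp add: I_def)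
      also have "\<dots> \<le> (\<Sum>e\<in>I. C + C1)" using cN by (intro sum_mono)
      also have "\<dots> \<le> 2 * C * (C + C1)" using \<open>card I \<le> 2 * C\<close>
        by (simp only: sum_constant of_nat_id mult_le_mono1)
      finally have cK: "card K \<le> 2 * C * (C + C1)" .
      have finK: "finite K" unfolding K_def I_def by simp
      have NK: "k \<le> card (N u \<inter> K)" if u: "u \<in> P" for u
      proof -
        have "\<not> T u \<subseteq> M w" using TS[OF u] sw by auto
        then obtain X Y where XY: "X \<subseteq> M w" "Y \<subseteq> N u" "card X = k + 1" "card Y = k" "X \<times> Y \<subseteq> E"
          using dichotomy[OF u sw(2) notw[OF u]] by blast
        have "\<not> X \<subseteq> S" using XY(3) S(2) card_mono[of S X] finite_subset[OF S(3)] by auto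
        then obtain e where e: "e \<in> X" "e \<notin> S" by auto
        have "e \<in> I" using e XY(1) notw M_subset[of w] unfolding I_def by auto
        then have "Y \<subseteq> N u \<inter> K" using XY(2,5) e unfolding K_def by auto
        from card_mono[OF _ this] show ?thesis using XY(4) by simp
      qed
      \<comment> \<open>\<open>K\<close> contains \<open>k\<close> of the \<open>k + 1\<close>
        neighbours of \<open>x\<close> but not \<open>v\<close>, hence all the others; the required
        \<open>k + 1\<close> vertices are \<open>x\<close> and \<open>S = T x\<close>.\<close>
      have "linked K v" if v: "v \<in> G" "v \<notin> K" for v
      proof -
        have "card (M v \<inter> A) < card (M v)" using min_M[of v] v(1) by (auto simp: G_def)
        then have "M v \<inter> A \<noteq> M v" by auto
        then obtain x where x: "x \<in> M v - A" by auto
        then have xP: "x \<in> P" using v(1) by (auto simp: G_def)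
        have "N x \<inter> K \<subseteq> N x - {v}" using v(2) by auto
        moreover have "card (N x - {v}) = k" using x xP by (simp add: P_def)
        ultimately have "N x \<inter> K = N x - {v}" using NK[OF xP] by (intro card_seteq) auto
        then have 1: "N x - {v} \<subseteq> K" by auto
        have "insert x S \<subseteq> M v" using x MS[OF v(1)] by auto
        moreover have "x \<notin> S" using x S(3) by auto
        then have "card (insert x S) = k + 1" using S(2) finite_subset[OF S(3)] by simp
        moreover have "insert x S \<times> (N x - {v}) \<subseteq> E" using TS[OF xP] by (auto simp: T_def)
        ultimately have "\<exists>X\<subseteq>M v. card X = k + 1 \<and> X \<times> (N x - {v}) \<subseteq> E" by blast
        then show ?thesis unfolding linked_def using 1 xP x by blast
      qed
      then have "card {v. v < n \<and> \<not> (v \<in> G \<and> v \<notin> K \<and> linked K v)} \<le> C1 + card K"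
        using finK by (intro card_bad_le)
      then have "card {v. v < n \<and> \<not> (v \<in> G \<and> v \<notin> K \<and> linked K v)} \<le> c"
        using cK unfolding c by linarith
      then show ?thesis by (rule good_if_linked)
    qed
  qed
qed

end

section \<open>The excess over \<open>2kn\<close>\<close>

text \<open>The two type conditions are what \<open>core_type\<close> derives from saturation;
  \<open>few_edges\<close> is harmless because a graph with more edges is good.\<close>

locale core = saturated +
  fixes A B :: "nat set" and a D :: nat
  assumes min_N: "u < n \<Longrightarrow> k + 1 \<le> card (N u)" and min_M: "v < n \<Longrightarrow> k + 1 \<le> card (M v)"
    and A: "A \<subseteq> {..<n}" "card A \<le> a" and B: "B \<subseteq> {..<n}" "card B \<le> a"
    and type_M: "v < n \<Longrightarrow> v \<notin> B \<Longrightarrow> card (M v \<inter> A) < k \<Longrightarrow> k + 1 \<le> card {u \<in> M v. k \<le> card (N u \<inter> B)}"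
    and type_N: "u < n \<Longrightarrow> u \<notin> A \<Longrightarrow> card (N u \<inter> B) < k \<Longrightarrow> k + 1 \<le> card {v \<in> N u. k \<le> card (M v \<inter> A)}"
    and D: "D = (k + 1) * 2 ^ a"
    and few_edges: "card E \<le> (2 * k + 1) * n"
begin

lemma core_conv: "core n k (E\<inverse>) B A a D"
proof -
  interpret conv: saturated n k "E\<inverse>" by (rule conv)
  show ?thesis using min_N min_M A B type_M type_N D few_edges card_E_conv
    by unfold_locales (simp_all only: converse_converse)
qed

definition Xm where "Xm = {u. u < n \<and> u \<notin> A \<and> card (N u \<inter> B) < k}"
definition Xp where "Xp = {u. u < n \<and> u \<notin> A \<and> k \<le> card (N u \<inter> B)}"
definition Ym where "Ym = {v. v < n \<and> v \<notin> B \<and> card (M v \<inter> A) < k}"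
definition Yp where "Yp = {v. v < n \<and> v \<notin> B \<and> k \<le> card (M v \<inter> A)}"
definition Xb where "Xb = {u \<in> Xp. card (N u \<inter> B) = k \<and> N u \<inter> Yp = {}}"
definition Yb where "Yb = {v \<in> Yp. card (M v \<inter> A) = k \<and> M v \<inter> Xp = {}}"
text \<open>The edges at \<open>Xm\<close> and \<open>Xp\<close> going to \<open>B \<union> Yp\<close>, together with all those at \<open>Ym\<close>, exceed \<open>k\<close> per
  vertex by \<open>g\<close> and \<open>h\<close>; only vertices of \<open>Xb\<close> contribute no excess.\<close>

definition g where "g u = card (N u \<inter> B) + card (N u \<inter> Yp) - k"
definition h where "h v = card (M v) - k"

interpretation dual: core n k "E\<inverse>" B A a D by (rule core_conv)

lemma dual_simps [simp]:
  "dual.Xm = Ym" "dual.Xp = Yp" "dual.Ym = Xm" "dual.Yp = Xp" "dual.Xb = Yb" "dual.Yb = Xb"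
  unfolding dual.Xm_def dual.Xp_def dual.Ym_def dual.Yp_def dual.Xb_def dual.Yb_def
    Xm_def Xp_def Ym_def Yp_def Xb_def Yb_def
  by (simp_all only: converse_converse simp_thms)

lemma finite_sets [simp]: "finite A" "finite B" "finite Xm" "finite Xp" "finite Ym" "finite Yp" "finite Xb" "finite Yb"
  using A(1) B(1) finite_subset by (auto simp: Xm_def Xp_def Ym_def Yp_def Xb_def Yb_def)

section \<open>Few common neighbours over bounded sets\<close>

lemma card_subsets_A: "card {R. R \<subseteq> A \<and> card R = j} \<le> 2 ^ a"
proof -
  have "card {R. R \<subseteq> A \<and> card R = j} \<le> card (Pow A)" by (intro card_mono) auto
  also have "\<dots> \<le> 2 ^ a" using A(2) by (simp add: card_Pow)
  finally show ?thesis .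
qed

text \<open>Each such neighbour sees a \<open>k\<close>-subset of \<open>A\<close>; that subset with
  \<open>x\<close> has at most \<open>k + 1\<close> common neighbours, and there are at most
  \<open>2 ^ a\<close> subsets.\<close>

lemma card_N_Yp:
  assumes x: "x < n" "x \<notin> A"
  shows "card (N x \<inter> Yp) \<le> D"
proof -
  let ?I = "{R. R \<subseteq> A \<and> card R = k}" and ?F = "\<lambda>R. {v. v < n \<and> insert x R \<subseteq> M v}"
  have finI: "finite ?I" by (rule finite_subset[of _ "Pow A"]) auto
  have "N x \<inter> Yp \<subseteq> (\<Union>R\<in>?I. ?F R)"
  proof
    fix v assume v: "v \<in> N x \<inter> Yp"
    then obtain R where "R \<subseteq> M v \<inter> A" "card R = k"
      using ex_subset_card[of "M v \<inter> A" k] by (auto simp: Yp_def)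
    then show "v \<in> (\<Union>R\<in>?I. ?F R)" using v by (auto simp: Yp_def intro!: exI[of _ R])
  qed
  then have "card (N x \<inter> Yp) \<le> (\<Sum>R\<in>?I. card (?F R))" using finI by (intro card_le_sum_cover) auto
  also have "\<dots> \<le> (\<Sum>R\<in>?I. k + 1)"
  proof (rule sum_mono)
    fix R assume R: "R \<in> ?I"
    then have "finite R" "x \<notin> R" using x finite_subset[of R A] by auto
    then have "card (insert x R) = k + 1" using R by simp
    then show "card (?F R) \<le> k + 1" by (rule free_right) auto
  qed
  also have "\<dots> \<le> D" using mult_le_mono2[OF card_subsets_A[of k], of "k + 1"] D by (simp add: mult.commute)
  finally show ?thesis .
qed

lemma card_Yp_rich: "card {v \<in> Yp. card (M v \<inter> A) \<noteq> k} \<le> D"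
proof -
  let ?I = "{R. R \<subseteq> A \<and> card R = k + 1}" and ?F = "\<lambda>R. {v. v < n \<and> R \<subseteq> M v}"
  have finI: "finite ?I" by (rule finite_subset[of _ "Pow A"]) auto
  have "{v \<in> Yp. card (M v \<inter> A) \<noteq> k} \<subseteq> (\<Union>R\<in>?I. ?F R)"
  proof
    fix v assume v: "v \<in> {v \<in> Yp. card (M v \<inter> A) \<noteq> k}"
    then have "k + 1 \<le> card (M v \<inter> A)" by (auto simp: Yp_def)
    then obtain R where "R \<subseteq> M v \<inter> A" "card R = k + 1"
      using ex_subset_card[of "M v \<inter> A" "k + 1"] by auto
    then show "v \<in> (\<Union>R\<in>?I. ?F R)" using v by (auto simp: Yp_def intro!: exI[of _ R])
  qed
  then have "card {v \<in> Yp. card (M v \<inter> A) \<noteq> k} \<le> (\<Sum>R\<in>?I. card (?F R))"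
    using finI by (intro card_le_sum_cover) auto
  also have "\<dots> \<le> (\<Sum>R\<in>?I. k + 1)"
  proof (rule sum_mono)
    fix R assume "R \<in> ?I"
    then have "card R = k + 1" by simp
    then show "card (?F R) \<le> k + 1" by (rule free_right) auto
  qed
  also have "\<dots> \<le> D" using mult_le_mono2[OF card_subsets_A[of "k + 1"], of "k + 1"] D by (simp add: mult.commute)
  finally show ?thesis .
qed

lemma Ym_degree:
  assumes y: "y \<in> Ym"
  shows "k + 1 \<le> card (M y \<inter> A) + card (M y \<inter> Xp)"
proof -
  have "{u \<in> M y. k \<le> card (N u \<inter> B)} \<subseteq> (M y \<inter> A) \<union> (M y \<inter> Xp)"
    using M_subset[of y] by (auto simp: Xp_def)
  then have "card {u \<in> M y. k \<le> card (N u \<inter> B)} \<le> card ((M y \<inter> A) \<union> (M y \<inter> Xp))"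
    by (intro card_mono) auto
  then show ?thesis using type_M[of y] y card_Un_le[of "M y \<inter> A" "M y \<inter> Xp"] by (auto simp: Ym_def)
qed

lemma degree_split: "card (M y) = card (M y \<inter> A) + card (M y \<inter> Xp) + card (M y \<inter> Xm)"
proof -
  have "M y = (M y \<inter> A) \<union> ((M y \<inter> Xp) \<union> (M y \<inter> Xm))" using M_subset[of y] by (auto simp: Xp_def Xm_def)
  then have "card (M y) = card ((M y \<inter> A) \<union> ((M y \<inter> Xp) \<union> (M y \<inter> Xm)))" by simp
  also have "\<dots> = card (M y \<inter> A) + card ((M y \<inter> Xp) \<union> (M y \<inter> Xm))"
    by (rule card_Un_disjoint) (auto simp: Xp_def Xm_def)
  also have "card ((M y \<inter> Xp) \<union> (M y \<inter> Xm)) = card (M y \<inter> Xp) + card (M y \<inter> Xm)"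
    by (rule card_Un_disjoint) (auto simp: Xp_def Xm_def)
  finally show ?thesis by simp
qed

lemma Xm_degree: "x \<in> Xm \<Longrightarrow> k + 1 \<le> card (N x \<inter> B) + card (N x \<inter> Yp)"
  using core.Ym_degree[OF core_conv] by simp

lemma degree_split_N: "card (N x) = card (N x \<inter> B) + card (N x \<inter> Yp) + card (N x \<inter> Ym)"
  using core.degree_split[OF core_conv, of x] by simp

section \<open>The excess and the vertices without excess\<close>

definition X where "X = Xm \<union> Xp"

lemma X_eq: "X = {..<n} - A" by (auto simp: X_def Xm_def Xp_def)

lemma finite_X [simp]: "finite X" by (simp add: X_def)

lemma card_X: "n \<le> card X + a" using A by (simp add: X_eq card_Diff_subset)

lemma card_Y: "n \<le> card Yp + card Ym + a"
proof -
  have "Yp \<union> Ym = {..<n} - B" by (auto simp: Yp_def Ym_def)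
  then have "card (Yp \<union> Ym) = n - card B" using B(1) by (simp add: card_Diff_subset)
  moreover have "card (Yp \<union> Ym) = card Yp + card Ym" by (rule card_Un_disjoint) (auto simp: Yp_def Ym_def)
  ultimately show ?thesis using B(2) by simp
qed

lemma g_ge: "x \<in> X \<Longrightarrow> card (N x \<inter> B) + card (N x \<inter> Yp) = k + g x"
  using Xm_degree[of x] by (auto simp: X_def Xp_def g_def)

lemma g_pos:
  assumes x: "x \<in> X - Xb"
  shows "0 < g x"
proof (cases "x \<in> Xm")
  case True
  then show ?thesis using Xm_degree[of x] by (simp add: g_def)
next
  case False
  then have "k \<le> card (N x \<inter> B)" "card (N x \<inter> B) \<noteq> k \<or> card (N x \<inter> Yp) > 0"
    using x by (auto simp: X_def Xb_def Xp_def card_gt_0_iff)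
  then show ?thesis by (auto simp: g_def)
qed

lemma h_pos: "y \<in> Ym \<Longrightarrow> 0 < h y" and h_eq: "y \<in> Ym \<Longrightarrow> card (M y) = k + h y"
  using min_M[of y] by (auto simp: h_def Ym_def)

text \<open>Count edges from \<open>X\<close> to \<open>B \<union> Yp\<close>, \<open>k\<close>
  edges to \<open>A\<close> per vertex of \<open>Yp\<close>, and all edges at \<open>Ym\<close>;
  none is counted twice. Leaving out \<open>A\<close> and \<open>B\<close> costs at most
  \<open>2 * k * a\<close>.\<close>

lemma excess: "(\<Sum>x\<in>X. g x) + (\<Sum>y\<in>Ym. h y) \<le> n + 2 * k * a"
proof -
  have U: "{..<n} = B \<union> (Yp \<union> Ym)" using B(1) by (auto simp: Yp_def Ym_def)
  have "card E = (\<Sum>v\<in>B. card (M v)) + ((\<Sum>v\<in>Yp. card (M v)) + (\<Sum>v\<in>Ym. card (M v)))"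
    unfolding card_E_right U
    by (subst sum.union_disjoint, simp, simp, force simp: Yp_def Ym_def)
      (subst sum.union_disjoint, auto simp: Yp_def Ym_def)
  moreover have "edges E X B \<le> (\<Sum>v\<in>B. card (M v))"
    unfolding edges_right[OF finite_X finite_sets(2)] by (intro sum_mono card_mono) auto
  moreover have "k * card Yp + edges E X Yp \<le> (\<Sum>v\<in>Yp. card (M v))"
  proof -
    have "k + card (M v \<inter> X) \<le> card (M v)" if "v \<in> Yp" for v
    proof -
      have "M v \<inter> X = M v - A" using M_subset[of v] by (auto simp: X_eq)
      then show ?thesis using card_Int_Diff_split[of "M v" A] that by (simp add: Yp_def)
    qed
    then have "(\<Sum>v\<in>Yp. k + card (M v \<inter> X)) \<le> (\<Sum>v\<in>Yp. card (M v))" by (intro sum_mono)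
    then show ?thesis by (simp add: edges_right sum.distrib mult.commute)
  qed
  moreover have "(\<Sum>v\<in>Ym. card (M v)) = k * card Ym + (\<Sum>y\<in>Ym. h y)"
    using h_eq by (simp add: sum.distrib)
  moreover have "edges E X B + edges E X Yp = k * card X + (\<Sum>x\<in>X. g x)"
  proof -
    have "edges E X B + edges E X Yp = (\<Sum>x\<in>X. card (N x \<inter> B) + card (N x \<inter> Yp))"
      by (simp add: edges_left sum.distrib)
    also have "\<dots> = (\<Sum>x\<in>X. k + g x)" using g_ge by (intro sum.cong) auto
    finally show ?thesis by (simp add: sum.distrib)
  qed
  ultimately have "k * card X + k * (card Yp + card Ym) + ((\<Sum>x\<in>X. g x) + (\<Sum>y\<in>Ym. h y)) \<le> (2 * k + 1) * n"
    using few_edges by (simp add: algebra_simps)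
  moreover have "k * n \<le> k * card X + k * a" "k * n \<le> k * (card Yp + card Ym) + k * a"
    using mult_le_mono2[OF card_X, of k] mult_le_mono2[OF card_Y, of k] by (simp_all add: algebra_simps)
  ultimately show ?thesis by (simp add: algebra_simps)
qed

text \<open>The resulting paths \<open>x, y', x', y\<close> branch boundedly at \<open>x'\<close>, so a large \<open>Yb\<close> forces a large
  excess on the neighbours in \<open>Ym\<close> of every vertex of \<open>Xb\<close>. Hence \<open>Xb\<close> or \<open>Yb\<close> is bounded.\<close>

lemma missing_bad:
  assumes x: "x \<in> Xb" and y: "y \<in> Yb"
  shows "\<exists>x'\<in>M y \<inter> Xm. \<exists>y'\<in>N x \<inter> Ym. (x', y') \<in> E"
proof -
  have x': "x < n" "card (N x \<inter> B) = k" "N x \<inter> Yp = {}" using x by (auto simp: Xb_def Xp_def)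
  have y': "y < n" "card (M y \<inter> A) = k" "M y \<inter> Xp = {}" "y \<in> Yp" using y by (auto simp: Yb_def Yp_def)
  have "(x, y) \<notin> E" using x'(3) y'(4) by auto
  then obtain R T where RT: "R \<subseteq> M y" "T \<subseteq> N x" "R \<times> T \<subseteq> E"
    "card R = k \<and> card T = k + 1 \<or> card R = k + 1 \<and> card T = k"
    using missing[of x y] x'(1) y'(1) by metis
  have "{..<n} \<subseteq> A \<union> Xm \<union> Xp" by (auto simp: Xm_def Xp_def)
  then have R: "R \<subseteq> A \<union> Xm" using RT(1) y'(3) M_subset[of y] by blast
  have "{..<n} \<subseteq> B \<union> Ym \<union> Yp" by (auto simp: Ym_def Yp_def)
  then have T: "T \<subseteq> B \<union> Ym" using RT(2) x'(3) N_subset[of x] by blast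
  have Rle: "card R \<le> k" if "R \<subseteq> A"
  proof -
    have "R \<subseteq> M y \<inter> A" using that RT(1) by auto
    from card_mono[OF _ this] show ?thesis using y'(2) by simp
  qed
  have Tle: "card T \<le> k" if "T \<subseteq> B"
  proof -
    have "T \<subseteq> N x \<inter> B" using that RT(2) by auto
    from card_mono[OF _ this] show ?thesis using x'(2) by simp
  qed
  have Tlt: "card T < k" if "u \<in> R" "u \<in> Xm" "T \<subseteq> B" for u
  proof -
    have "T \<subseteq> N u \<inter> B" using that RT(3) by auto
    from card_mono[OF _ this] show ?thesis using that(2) by (simp add: Xm_def)
  qed
  have Rlt: "card R < k" if "v \<in> T" "v \<in> Ym" "R \<subseteq> A" for v
  proof -
    have "R \<subseteq> M v \<inter> A" using that RT(3) by auto
    from card_mono[OF _ this] show ?thesis using that(2) by (simp add: Ym_def)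
  qed
  \<comment> \<open>Otherwise \<open>T\<close> has \<open>k + 1\<close> vertices, too many for
    \<open>B\<close>, and so meets \<open>Ym\<close>, whose vertices have fewer than
    \<open>k\<close> neighbours in \<open>A\<close>.\<close>
  have "\<not> R \<subseteq> A"
  proof
    assume RA: "R \<subseteq> A"
    then have "card R = k" "card T = k + 1" using RT(4) Rle by auto
    then have "\<not> T \<subseteq> B" using Tle by auto
    then obtain v where "v \<in> T" "v \<in> Ym" using T by auto
    then show False using Rlt RA \<open>card R = k\<close> by fastforce
  qed
  then obtain u where u: "u \<in> R" "u \<in> Xm" using R by auto
  have "\<not> T \<subseteq> B" using Tlt[OF u] RT(4) by auto
  then obtain v where "v \<in> T" "v \<in> Ym" using T by auto
  then show ?thesis using u RT(1-3) by blast
qed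

text \<open>Along the paths from \<open>x\<close> there are at most \<open>k + 1\<close>,
  \<open>2 * D\<close> and \<open>D\<close> choices.\<close>

lemma card_Yb_le:
  assumes x: "x \<in> Xb" and d: "card (N x \<inter> Ym) \<le> k + 1"
    and light: "\<And>y. y \<in> N x \<inter> Ym \<Longrightarrow> card (M y \<inter> Xm) \<le> 2 * D"
  shows "card Yb \<le> (k + 1) * (2 * D * D)"
proof -
  have "Yb \<subseteq> (\<Union>y\<in>N x \<inter> Ym. \<Union>x'\<in>M y \<inter> Xm. N x' \<inter> Yp)"
  proof
    fix v assume v: "v \<in> Yb"
    then obtain x' y where "x' \<in> M v \<inter> Xm" "y \<in> N x \<inter> Ym" "(x', y) \<in> E" using missing_bad[OF x] by blast
    moreover have "v \<in> Yp" using v by (simp add: Yb_def)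
    ultimately show "v \<in> (\<Union>y\<in>N x \<inter> Ym. \<Union>x'\<in>M y \<inter> Xm. N x' \<inter> Yp)" by blast
  qed
  then have "card Yb \<le> (\<Sum>y\<in>N x \<inter> Ym. card (\<Union>x'\<in>M y \<inter> Xm. N x' \<inter> Yp))"
    by (intro card_le_sum_cover) auto
  also have "\<dots> \<le> (\<Sum>y\<in>N x \<inter> Ym. 2 * D * D)"
  proof (rule sum_mono)
    fix y assume y: "y \<in> N x \<inter> Ym"
    have "card (\<Union>x'\<in>M y \<inter> Xm. N x' \<inter> Yp) \<le> (\<Sum>x'\<in>M y \<inter> Xm. card (N x' \<inter> Yp))" by (rule card_UN_le) simp
    also have "\<dots> \<le> (\<Sum>x'\<in>M y \<inter> Xm. D)" using card_N_Yp by (intro sum_mono) (auto simp: Xm_def)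
    also have "\<dots> \<le> 2 * D * D" using light[OF y] by (simp only: sum_constant of_nat_id mult_le_mono1)
    finally show "card (\<Union>x'\<in>M y \<inter> Xm. N x' \<inter> Yp) \<le> 2 * D * D" .
  qed
  also have "\<dots> \<le> (k + 1) * (2 * D * D)" using d by (simp only: sum_constant of_nat_id mult_le_mono1)
  finally show ?thesis .
qed

text \<open>Weighted double counting between \<open>Xb\<close> and \<open>Ym\<close>: by
  \<open>card_Yb_le\<close>, a vertex of \<open>Xb\<close> has \<open>k + 2\<close> neighbours in
  \<open>Ym\<close> or one of large weight.\<close>

lemma card_Xb_weighted:
  assumes "(k + 1) * (2 * D * D) < card Yb"
  shows "(k + 2) * card Xb \<le> (k + 1) * (\<Sum>y\<in>Ym. h y)"
proof -
  \<comment> \<open>At a heavy \<open>y\<close>, \<open>h y\<close> is at least twice the number of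
    neighbours in \<open>Xb\<close>, which is at most \<open>D\<close>; this affords weight
    \<open>k + 2\<close>, as \<open>k + 2 \<le> 2 * (k + 1)\<close>.\<close>
  define w where "w y = (if 2 * D < card (M y \<inter> Xm) then k + 2 else 1)" for y
  have pay: "card (M y \<inter> Xb) * w y \<le> (k + 1) * h y" if y: "y \<in> Ym" for y
  proof -
    define d where "d = card (M y \<inter> Xb)"
    have d1: "d \<le> card (M y \<inter> Xp)" unfolding d_def by (intro card_mono) (auto simp: Xb_def)
    have "card (M y \<inter> Xp) \<le> D" using core.card_N_Yp[OF core_conv, of y] y by (simp add: Ym_def)
    then have dD: "d \<le> D" using d1 by simp
    show ?thesis
    proof (cases "2 * D < card (M y \<inter> Xm)")
      case True
      then have "2 * d \<le> h y" using Ym_degree[OF y] degree_split[of y] h_eq[OF y] dD by linarith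
      then have "(k + 1) * (2 * d) \<le> (k + 1) * h y" by (rule mult_le_mono2)
      moreover have "d * (k + 2) \<le> (k + 1) * (2 * d)" by (simp add: algebra_simps)
      ultimately have "d * (k + 2) \<le> (k + 1) * h y" by (rule order_trans[rotated])
      then show ?thesis using True by (simp only: w_def d_def if_True)
    next
      case False
      have "d \<le> k + h y" using d1 degree_split[of y] h_eq[OF y] by linarith
      moreover have "k \<le> k * h y" using h_pos[OF y] by simp
      moreover have "(k + 1) * h y = k * h y + h y" by simp
      ultimately have "d \<le> (k + 1) * h y" by linarith
      then show ?thesis using False unfolding w_def d_def by simp
    qed
  qed
  have collect: "k + 2 \<le> (\<Sum>y\<in>N x \<inter> Ym. w y)" if x: "x \<in> Xb" for x
  proof (cases "card (N x \<inter> Ym) \<le> k + 1")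
    case True
    then obtain y where y: "y \<in> N x \<inter> Ym" "2 * D < card (M y \<inter> Xm)"
      using card_Yb_le[OF x] assms by (meson not_less)
    have "w y \<le> (\<Sum>y\<in>N x \<inter> Ym. w y)" using y(1) by (intro member_le_sum) auto
    then show ?thesis using y(2) by (simp add: w_def)
  next
    case False
    have "(\<Sum>y\<in>N x \<inter> Ym. 1) \<le> (\<Sum>y\<in>N x \<inter> Ym. w y)" by (intro sum_mono) (simp add: w_def)
    then show ?thesis using False by simp
  qed
  have "(k + 2) * card Xb = (\<Sum>x\<in>Xb. k + 2)" by simp
  also have "\<dots> \<le> (\<Sum>x\<in>Xb. \<Sum>y\<in>N x \<inter> Ym. w y)" using collect by (intro sum_mono)
  also have "\<dots> = (\<Sum>x\<in>Xb. \<Sum>y | y \<in> Ym \<and> (x, y) \<in> E. w y)" by (intro sum.cong refl) auto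
  also have "\<dots> = (\<Sum>y\<in>Ym. \<Sum>x | x \<in> Xb \<and> (x, y) \<in> E. w y)" by (rule sum.swap_restrict) auto
  also have "\<dots> = (\<Sum>y\<in>Ym. card (M y \<inter> Xb) * w y)"
  proof (intro sum.cong refl)
    fix y
    have "{x. x \<in> Xb \<and> (x, y) \<in> E} = M y \<inter> Xb" by auto
    then show "(\<Sum>x | x \<in> Xb \<and> (x, y) \<in> E. w y) = card (M y \<inter> Xb) * w y" by simp
  qed
  also have "\<dots> \<le> (\<Sum>y\<in>Ym. (k + 1) * h y)" using pay by (intro sum_mono)
  finally show ?thesis by (simp only: sum_distrib_left)
qed

lemma sum_g_ge: "card X \<le> (\<Sum>x\<in>X. g x) + card Xb"
proof -
  have "card (X - Xb) = (\<Sum>x\<in>X - Xb. 1)" by simp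
  also have "\<dots> \<le> (\<Sum>x\<in>X - Xb. g x)" using g_pos by (intro sum_mono) (simp add: Suc_le_eq)
  also have "\<dots> \<le> (\<Sum>x\<in>X. g x)" by (intro sum_mono2) auto
  finally have "card (X - Xb) \<le> (\<Sum>x\<in>X. g x)" .
  moreover have "Xb \<subseteq> X" by (auto simp: Xb_def X_def)
  ultimately show ?thesis using card_Diff_subset[of Xb X] by simp
qed

text \<open>Vertices of \<open>X - Xb\<close> use at least one unit of excess each, so the sum of
  \<open>h\<close> exceeds \<open>card Xb\<close> by at most a constant. The factor
  \<open>k + 2\<close> against \<open>k + 1\<close> then bounds \<open>Xb\<close>.\<close>

lemma card_Xb_le:
  assumes "(k + 1) * (2 * D * D) < card Yb"
  shows "card Xb \<le> (k + 1) * (a + 2 * k * a)"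
proof -
  have "n + (\<Sum>y\<in>Ym. h y) \<le> n + 2 * k * a + a + card Xb" using excess sum_g_ge card_X by linarith
  then have "(\<Sum>y\<in>Ym. h y) \<le> (a + 2 * k * a) + card Xb" by linarith
  then have "(k + 1) * (\<Sum>y\<in>Ym. h y) \<le> (k + 1) * ((a + 2 * k * a) + card Xb)" by (rule mult_le_mono2)
  then have "(k + 2) * card Xb \<le> (k + 1) * (a + 2 * k * a) + (k + 1) * card Xb"
    using card_Xb_weighted[OF assms] by (simp only: add_mult_distrib2)
  then show ?thesis by simp
qed

text \<open>One unit per vertex of \<open>X - Xb\<close> uses up the excess except for
  \<open>m\<close>. So \<open>Ym\<close>, its neighbours and the vertices with \<open>g > 1\<close>
  are few, and the remaining vertices outside \<open>A\<close> and \<open>Xb\<close> have degree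
  \<open>k + 1\<close>. \<open>C\<close> sums these bounds.\<close>

lemma near_extremal_if:
  assumes b: "card Xb \<le> b" and m: "m = 2 * k * a + a + b" and C: "C = a + b + D + (k + 2) * m"
    and C1: "C1 = C + C * C" and c: "c = C1 + 2 * C * (C + C1) + C + k + 2" and large: "(k + 2) * c < n"
  shows "near_extremal n k E A C C1 c"
proof -
  let ?H = "{x \<in> X - Xb. 1 < g x}"
  have XbX: "Xb \<subseteq> X" by (auto simp: Xb_def X_def)
  have "(\<Sum>x\<in>X - Xb. 1 + (g x - 1)) = (\<Sum>x\<in>X - Xb. g x)" using g_pos by (intro sum.cong) (auto simp: Suc_le_eq)
  moreover have "(\<Sum>x\<in>X - Xb. g x) \<le> (\<Sum>x\<in>X. g x)" by (intro sum_mono2) auto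
  moreover have "(\<Sum>x\<in>X - Xb. 1 + (g x - 1)) = card (X - Xb) + (\<Sum>x\<in>X - Xb. g x - 1)" by (simp only: sum.distrib sum_constant of_nat_id mult_1_right)
  moreover have "card X \<le> card (X - Xb) + b" using card_Diff_subset[OF _ XbX] b by simp
  ultimately have tot: "(\<Sum>x\<in>X - Xb. g x - 1) + (\<Sum>y\<in>Ym. h y) \<le> m" using excess card_X unfolding m by linarith
  have "card Ym = (\<Sum>y\<in>Ym. 1)" by simp
  also have "\<dots> \<le> (\<Sum>y\<in>Ym. h y)" using h_pos by (intro sum_mono) (simp add: Suc_le_eq)
  finally have cYm: "card Ym \<le> m" using tot by linarith
  have "card ?H = (\<Sum>x\<in>?H. 1)" by simp
  also have "\<dots> \<le> (\<Sum>x\<in>?H. g x - 1)" by (intro sum_mono) auto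
  also have "\<dots> \<le> (\<Sum>x\<in>X - Xb. g x - 1)" by (intro sum_mono2) auto
  finally have cH: "card ?H \<le> m" using tot by linarith
  have "card (\<Union>y\<in>Ym. M y) \<le> (\<Sum>y\<in>Ym. card (M y))" by (rule card_UN_le) simp
  also have "\<dots> = (\<Sum>y\<in>Ym. k + h y)" using h_eq by simp
  also have "\<dots> = k * card Ym + (\<Sum>y\<in>Ym. h y)" by (simp add: sum.distrib)
  also have "\<dots> \<le> k * m + m" using cYm tot by (intro add_mono mult_le_mono2) auto
  finally have cN: "card (\<Union>y\<in>Ym. M y) \<le> (k + 1) * m" by simp
  show ?thesis
  proof unfold_locales
    have "{u. u < n \<and> card (N u) \<noteq> k + 1} \<subseteq> A \<union> Xb \<union> ?H \<union> (\<Union>y\<in>Ym. M y)"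
    proof
      fix u assume u: "u \<in> {u. u < n \<and> card (N u) \<noteq> k + 1}"
      show "u \<in> A \<union> Xb \<union> ?H \<union> (\<Union>y\<in>Ym. M y)"
      proof (rule ccontr)
        assume no: "u \<notin> A \<union> Xb \<union> ?H \<union> (\<Union>y\<in>Ym. M y)"
        then have uX: "u \<in> X - Xb" using u by (auto simp: X_eq)
        then have "g u = 1" using no g_pos[OF uX] by auto
        moreover have "N u \<inter> Ym = {}" using no by auto
        ultimately have "card (N u) = k + 1" using g_ge[of u] degree_split_N[of u] uX by simp
        then show False using u by simp
      qed
    qed
    then have "card {u. u < n \<and> card (N u) \<noteq> k + 1} \<le> card (A \<union> Xb \<union> ?H \<union> (\<Union>y\<in>Ym. M y))"
      by (intro card_mono) auto
    also have "\<dots> \<le> card A + card Xb + card ?H + card (\<Union>y\<in>Ym. M y)"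
      using card_Un_le[of "A \<union> Xb \<union> ?H" "\<Union>y\<in>Ym. M y"] card_Un_le[of "A \<union> Xb" ?H] card_Un_le[of A Xb] by linarith
    finally show "card {u. u < n \<and> card (N u) \<noteq> k + 1} \<le> C" using A(2) b cH cN unfolding C by simp
    have mC: "a + D + m \<le> C" unfolding C by simp
    show "card (N u) \<le> C" if "u < n" "u \<notin> A" for u
    proof -
      have "card (N u \<inter> B) \<le> card B" "card (N u \<inter> Ym) \<le> card Ym" by (intro card_mono; simp)+
      then show ?thesis using degree_split_N[of u] card_N_Yp[OF that] B(2) cYm mC by linarith
    qed
    have "{v. v < n \<and> card (M v \<inter> A) \<noteq> k} \<subseteq> B \<union> Ym \<union> {v \<in> Yp. card (M v \<inter> A) \<noteq> k}"
      by (auto simp: Yp_def Ym_def)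
    then have "card {v. v < n \<and> card (M v \<inter> A) \<noteq> k} \<le> card (B \<union> Ym \<union> {v \<in> Yp. card (M v \<inter> A) \<noteq> k})"
      by (intro card_mono) auto
    also have "\<dots> \<le> card B + card Ym + card {v \<in> Yp. card (M v \<inter> A) \<noteq> k}"
      using card_Un_le[of "B \<union> Ym" "{v \<in> Yp. card (M v \<inter> A) \<noteq> k}"] card_Un_le[of B Ym] by linarith
    finally show "card {v. v < n \<and> card (M v \<inter> A) \<noteq> k} \<le> C" using B(2) cYm card_Yp_rich mC by linarith
    show "card A \<le> C" using A(2) unfolding C by simp
  qed (use min_N min_M A C1 c large in auto)
qed

text \<open>\<open>b\<close> is the sum of the threshold and the bound in \<open>card_Xb_le\<close>,
  so at least one of \<open>Xb\<close>, \<open>Yb\<close> has at most \<open>b\<close>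
  vertices.\<close>

lemma good_core:
  assumes b: "b = (k + 1) * (2 * D * D) + (k + 1) * (a + 2 * k * a)"
    and m: "m = 2 * k * a + a + b" and C: "C = a + b + D + (k + 2) * m"
    and C1: "C1 = C + C * C" and c: "c = C1 + 2 * C * (C + C1) + C + k + 2" and large: "(k + 2) * c < n"
  shows good
proof (cases "card Xb \<le> b")
  case True
  then show ?thesis using near_extremal.good_near_extremal[OF near_extremal_if[OF _ m C C1 c large]] by simp
next
  case False
  then have "(k + 1) * (2 * D * D) < card Xb" unfolding b by linarith
  then have "card Yb \<le> (k + 1) * (a + 2 * k * a)" using core.card_Xb_le[OF core_conv] by simp
  then have "card Yb \<le> b" unfolding b by linarith
  then have "near_extremal n k (E\<inverse>) B C C1 c" using core.near_extremal_if[OF core_conv _ m C C1 c large] by simp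
  then show ?thesis using near_extremal.good_near_extremal good_conv by blast
qed

end

section \<open>The lower bound\<close>

context saturated
begin

lemma card_rich_le:
  assumes B: "finite B" "card B \<le> j"
  shows "card {u. u < n \<and> k + 1 \<le> card (N u \<inter> B)} \<le> (k + 1) * 2 ^ j"
proof -
  let ?I = "{R. R \<subseteq> B \<and> card R = k + 1}" and ?F = "\<lambda>R. {u. u < n \<and> R \<subseteq> N u}"
  have finI: "finite ?I" by (rule finite_subset[of _ "Pow B"]) (use B(1) in auto)
  have "{u. u < n \<and> k + 1 \<le> card (N u \<inter> B)} \<subseteq> (\<Union>R\<in>?I. ?F R)"
  proof
    fix u assume u: "u \<in> {u. u < n \<and> k + 1 \<le> card (N u \<inter> B)}"
    then obtain R where "R \<subseteq> N u \<inter> B" "card R = k + 1"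
      using ex_subset_card[of "N u \<inter> B" "k + 1"] by auto
    then show "u \<in> (\<Union>R\<in>?I. ?F R)" using u by (auto intro!: exI[of _ R])
  qed
  then have "card {u. u < n \<and> k + 1 \<le> card (N u \<inter> B)} \<le> (\<Sum>R\<in>?I. card (?F R))"
    using finI by (intro card_le_sum_cover) auto
  also have "\<dots> \<le> (\<Sum>R\<in>?I. k + 1)"
  proof (rule sum_mono)
    fix R assume "R \<in> ?I"
    then have "card R = k + 1" by simp
    then show "card (?F R) \<le> k + 1" by (rule free_left) auto
  qed
  also have "\<dots> \<le> (k + 1) * 2 ^ j"
  proof -
    have "card ?I \<le> card (Pow B)" using B(1) by (intro card_mono) auto
    also have "\<dots> \<le> 2 ^ j" using B by (simp add: card_Pow)
    finally show ?thesis using mult_le_mono2[of "card ?I" "2 ^ j" "k + 1"] by (simp add: mult.commute)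
  qed
  finally show ?thesis .
qed

text \<open>A copy forced at \<open>(u0, v)\<close> with \<open>k + 1\<close> vertices in
  \<open>N u0\<close> would give \<open>v\<close> at least \<open>k\<close> neighbours in
  \<open>A\<close>. So it has \<open>k + 1\<close> vertices on the left, each with \<open>k\<close>
  neighbours in \<open>N u0\<close>.\<close>

lemma core_type:
  assumes u0: "u0 < n" and v: "v < n" "v \<notin> B" and B: "N u0 \<subseteq> B"
    and A: "{u. u < n \<and> k + 1 \<le> card (N u \<inter> N u0)} \<subseteq> A" and B': "finite B"
    and less: "card (M v \<inter> A) < k"
  shows "k + 1 \<le> card {u \<in> M v. k \<le> card (N u \<inter> B)}"
proof -
  have "(u0, v) \<notin> E" using v(2) B by auto
  then obtain X Y where XY: "X \<subseteq> M v" "Y \<subseteq> N u0" "X \<times> Y \<subseteq> E"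
    "card X = k \<and> card Y = k + 1 \<or> card X = k + 1 \<and> card Y = k"
    using missing[OF u0 v(1)] by metis
  have sub: "card Y \<le> card (N u \<inter> N u0)" if "u \<in> X" for u
    using XY(2,3) that by (intro card_mono) auto
  show ?thesis
  proof (cases "card X = k \<and> card Y = k + 1")
    case True
    have "X \<subseteq> M v \<inter> A"
    proof
      fix u assume u: "u \<in> X"
      then have "u < n" "k + 1 \<le> card (N u \<inter> N u0)" using sub True XY(1) M_subset[of v] by auto
      then show "u \<in> M v \<inter> A" using A u XY(1) by auto
    qed
    from card_mono[OF _ this] show ?thesis using True less by simp
  next
    case False
    have "X \<subseteq> {u \<in> M v. k \<le> card (N u \<inter> B)}"
    proof
      fix u assume u: "u \<in> X"
      have "card (N u \<inter> N u0) \<le> card (N u \<inter> B)" using B B' by (intro card_mono) auto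
      then show "u \<in> {u \<in> M v. k \<le> card (N u \<inter> B)}" using sub[OF u] False XY(4,1) u by auto
    qed
    moreover have "finite {u \<in> M v. k \<le> card (N u \<inter> B)}" by (rule finite_subset[OF _ finite_M[of v]]) auto
    ultimately have "card X \<le> card {u \<in> M v. k \<le> card (N u \<inter> B)}" by (intro card_mono)
    then show ?thesis using False XY(4) by auto
  qed
qed

lemma good_large:
  assumes a: "a = 2 * k + (k + 1) * 2 ^ (2 * k)" and D: "D = (k + 1) * 2 ^ a"
    and b: "b = (k + 1) * (2 * D * D) + (k + 1) * (a + 2 * k * a)"
    and m: "m = 2 * k * a + a + b" and C: "C = a + b + D + (k + 2) * m"
    and C1: "C1 = C + C * C" and c: "c = C1 + 2 * C * (C + C1) + C + k + 2" and large: "(k + 2) * c < n"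
  shows good
proof (rule ccontr)
  assume not_good: "\<not> good"
  have "k + 2 \<le> c" "2 * c \<le> (k + 2) * c" using c by simp_all
  then have n: "2 * k + 1 < n" using large by linarith
  have no_k: "card (N u) \<noteq> k" if "u < n" for u using good_if_degree_k that n not_good by blast
  have min_N: "k + 1 \<le> card (N u)" if "u < n" for u
    using min_degree[OF that] no_k[OF that] n by simp
  have no_k': "card (M v) \<noteq> k" if "v < n" for v
    using saturated.good_if_degree_k[OF conv that _ n] not_good good_conv by blast
  have min_M: "k + 1 \<le> card (M v)" if "v < n" for v
    using saturated.min_degree[OF conv that] no_k'[OF that] n by simp
  \<comment> \<open>For \<open>k = 0\<close> the empty set serves as the set of full vertices.
    Positivity of \<open>k\<close> makes the edge bound below strict.\<close>
  have "k \<noteq> 0"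
  proof
    assume "k = 0"
    then show False using good_if_full[of "{}"] min_N not_good by simp
  qed
  have "\<not> (2 * k + 1) * n < card E + k * (k + 1)" using not_good unfolding good_def by linarith
  then have E: "card E < (2 * k + 1) * n" using \<open>k \<noteq> 0\<close> by (simp add: not_less)
  have "\<exists>u0<n. card (N u0) \<le> 2 * k"
  proof (rule ccontr)
    assume "\<not> ?thesis"
    then have "(\<Sum>u<n. 2 * k + 1) \<le> (\<Sum>u<n. card (N u))" by (intro sum_mono) (auto simp: not_le Suc_le_eq)
    then show False using E card_E_left by (simp add: mult.commute)
  qed
  then obtain u0 where u0: "u0 < n" "card (N u0) \<le> 2 * k" by blast
  have "\<exists>v0<n. card (M v0) \<le> 2 * k"
  proof (rule ccontr)
    assume "\<not> ?thesis"
    then have "(\<Sum>u<n. 2 * k + 1) \<le> (\<Sum>u<n. card (M u))" by (intro sum_mono) (auto simp: not_le Suc_le_eq)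
    then show False using E card_E_right by (simp add: mult.commute)
  qed
  then obtain v0 where v0: "v0 < n" "card (M v0) \<le> 2 * k" by blast
  \<comment> \<open>The enlargement is what \<open>core_type\<close> requires; \<open>a\<close> adds
    the degree bound \<open>2 * k\<close> and the bound of \<open>card_rich_le\<close>.\<close>
  define A where "A = M v0 \<union> {u. u < n \<and> k + 1 \<le> card (N u \<inter> N u0)}"
  define B where "B = N u0 \<union> {v. v < n \<and> k + 1 \<le> card (M v \<inter> M v0)}"
  have "card A \<le> a"
    using card_Un_le[of "M v0" "{u. u < n \<and> k + 1 \<le> card (N u \<inter> N u0)}"] v0(2)
      card_rich_le[OF finite_N u0(2)] unfolding A_def a by linarith
  moreover have "card B \<le> a"
    using card_Un_le[of "N u0" "{v. v < n \<and> k + 1 \<le> card (M v \<inter> M v0)}"] u0(2)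
      saturated.card_rich_le[OF conv finite_M v0(2)] unfolding B_def a by linarith
  moreover have "A \<subseteq> {..<n}" "B \<subseteq> {..<n}" using edge_lt unfolding A_def B_def by auto
  moreover have "k + 1 \<le> card {u \<in> M v. k \<le> card (N u \<inter> B)}"
    if "v < n" "v \<notin> B" "card (M v \<inter> A) < k" for v
    by (rule core_type[OF u0(1) that(1,2) _ _ _ that(3)]) (auto simp: A_def B_def)
  moreover have "k + 1 \<le> card {v \<in> N u. k \<le> card (M v \<inter> A)}"
    if "u < n" "u \<notin> A" "card (N u \<inter> B) < k" for u
    using saturated.core_type[OF conv v0(1) that(1,2), of B] that(3) by (simp add: A_def B_def)
  ultimately have "core n k E A B a D" using min_N min_M D E by unfold_locales auto
  then show False using core.good_core b m C C1 c large not_good by blast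
qed

end

section \<open>The extremal family\<close>

text \<open>Provides the converse of the equality case and the size of the witness below.\<close>

lemma family_F_card:
  assumes F: "family_F n (k + 1) (k + 2) E" and kn: "k \<le> n"
  shows "card E + k * (k + 1) = (2 * k + 1) * n"
proof -
  have left: "card E + k * (k + 1) = (2 * k + 1) * n"
    if E: "E \<subseteq> {..<n} \<times> {..<n}" and S: "S \<subseteq> {..<n}" "card S = k" "\<forall>u\<in>S. \<forall>v<n. (u, v) \<in> E"
      "\<forall>u<n. u \<notin> S \<longrightarrow> card (E `` {u}) = k + 1" for E S
  proof -
    have fin: "finite S" using S(1) finite_subset by auto
    have "E `` {u} \<subseteq> {..<n}" for u using E by auto
    then have "edges E {..<n} {..<n} = (\<Sum>u<n. card (E `` {u}))" by (simp add: edges_left Int_absorb2)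
    moreover have "edges E {..<n} {..<n} = card E" using E by (simp add: edges_def Int_absorb2)
    moreover have "(\<Sum>u<n. card (E `` {u})) = (\<Sum>u\<in>{..<n} - S. card (E `` {u})) + (\<Sum>u\<in>S. card (E `` {u}))"
      using S(1) by (intro sum.subset_diff) auto
    moreover have "(\<Sum>u\<in>{..<n} - S. card (E `` {u})) = (\<Sum>u\<in>{..<n} - S. k + 1)"
      using S(4) by (intro sum.cong) auto
    moreover have "(\<Sum>u\<in>S. card (E `` {u})) = (\<Sum>u\<in>S. n)"
    proof (rule sum.cong)
      fix u assume "u \<in> S"
      then have "E `` {u} = {..<n}" using E S(3) by auto
      then show "card (E `` {u}) = n" by simp
    qed simp
    ultimately have "card E = (n - k) * (k + 1) + k * n"
      using S(1,2) fin by (simp add: card_Diff_subset del: mult_Suc_right)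
    moreover obtain m where "n = k + m" using kn le_Suc_ex by blast
    ultimately show ?thesis by (simp add: algebra_simps)
  qed
  have E: "E \<subseteq> {..<n} \<times> {..<n}" using F by (simp add: family_F_def bip_graph_def)
  from F consider S where "S \<subseteq> {..<n}" "card S = k" "\<forall>u\<in>S. \<forall>v<n. (u, v) \<in> E"
      "\<forall>u<n. u \<notin> S \<longrightarrow> card (E `` {u}) = k + 1"
    | S where "S \<subseteq> {..<n}" "card S = k" "\<forall>u\<in>S. \<forall>v<n. (u, v) \<in> E\<inverse>"
      "\<forall>u<n. u \<notin> S \<longrightarrow> card (E\<inverse> `` {u}) = k + 1"
    by (auto simp: family_F_def Image_singleton)
  then show ?thesis
  proof cases
    case 1
    then show ?thesis using left E by blast
  next
    case 2
    have "E\<inverse> \<subseteq> {..<n} \<times> {..<n}" using E by auto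
    then have "card (E\<inverse>) + k * (k + 1) = (2 * k + 1) * n" using left 2 by blast
    then show ?thesis by (simp add: card_inverse)
  qed
qed

text \<open>\<open>k\<close> full vertices in each class and a perfect matching between the
  remaining vertices.\<close>

definition extremal_graph :: "nat \<Rightarrow> nat \<Rightarrow> (nat \<times> nat) set" where
  "extremal_graph n k = {(u, v). u < n \<and> v < n \<and> (u < k \<or> v < k \<or> u = v)}"

lemma extremal_graph_conv: "(u, v) \<in> extremal_graph n k \<longleftrightarrow> (v, u) \<in> extremal_graph n k"
  by (auto simp: extremal_graph_def)

lemma extremal_graph_family:
  assumes "k \<le> n"
  shows "Kst_saturated n (k + 1) (k + 2) (extremal_graph n k)"
    and "family_F n (k + 1) (k + 2) (extremal_graph n k)"
proof -
  let ?E = "extremal_graph n k"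
  have sub: "bip_graph n ?E" by (auto simp: bip_graph_def extremal_graph_def)
  have nbh: "{v. (u, v) \<in> ?E} = insert u {..<k}" if "u < n" "k \<le> u" for u
    using that assms by (auto simp: extremal_graph_def)
  \<comment> \<open>Some vertex of \<open>X\<close> has index at least \<open>k\<close> and hence
    degree only \<open>k + 1\<close>.\<close>
  have no: False if X: "X \<subseteq> {..<n}" "card X = k + 1" "card Y = k + 2" "X \<times> Y \<subseteq> ?E" for X Y
  proof -
    have "\<not> X \<subseteq> {..<k}" using X(2) card_mono[of "{..<k}" X] by auto
    then obtain u where u: "u \<in> X" "k \<le> u" by (meson lessThan_iff not_less subsetI)
    then have "Y \<subseteq> insert u {..<k}" using nbh[of u] X(1,4) by auto
    from card_mono[OF _ this] show False using X(3) u(2) by simp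
  qed
  have free: "\<not> contains_Kst n (k + 1) (k + 2) ?E"
  proof
    assume "contains_Kst n (k + 1) (k + 2) ?E"
    then obtain X Y where XY: "X \<subseteq> {..<n}" "Y \<subseteq> {..<n}"
      "card X = k + 1 \<and> card Y = k + 2 \<or> card X = k + 2 \<and> card Y = k + 1" "X \<times> Y \<subseteq> ?E"
      unfolding contains_Kst_def by blast
    have "Y \<times> X \<subseteq> ?E" using XY(4) extremal_graph_conv by blast
    then show False using no XY by blast
  qed
  have "contains_Kst n (k + 1) (k + 2) (insert (u, v) ?E)"
    if "u < n" "v < n" "(u, v) \<notin> ?E" for u v
  proof -
    have uv: "k \<le> u" "k \<le> v" "u \<noteq> v" using that by (auto simp: extremal_graph_def)
    have "insert u {..<k} \<subseteq> {..<n}" "insert u (insert v {..<k}) \<subseteq> {..<n}" using that assms by auto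
    moreover have "card (insert u {..<k}) = k + 1" "card (insert u (insert v {..<k})) = k + 2" using uv by simp_all
    moreover have "insert u {..<k} \<times> insert u (insert v {..<k}) \<subseteq> insert (u, v) ?E"
      using that assms by (auto simp: extremal_graph_def)
    ultimately show ?thesis unfolding contains_Kst_def by blast
  qed
  then show "Kst_saturated n (k + 1) (k + 2) ?E" using sub free by (auto simp: Kst_saturated_def)
  have "{..<k} \<subseteq> {..<n} \<and> card {..<k} = k + 1 - 1 \<and> (\<forall>u\<in>{..<k}. \<forall>v<n. (u, v) \<in> ?E) \<and>
      (\<forall>u<n. u \<notin> {..<k} \<longrightarrow> card {v. (u, v) \<in> ?E} = k + 2 - 1)"
    using nbh assms by (auto simp: extremal_graph_def)
  then show "family_F n (k + 1) (k + 2) ?E" using sub free unfolding family_F_def by blast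
qed

theorem theorem1p2:
  fixes t :: nat
  assumes "t > 1"
  shows "\<exists>N. \<forall>n\<ge>N.
     int (sat_bip n (t - 1) t) = (2 * int t - 3) * int n - (int t - 1) * (int t - 2) \<and>
     (\<forall>E. Kst_saturated n (t - 1) t E \<longrightarrow>
        (card E = sat_bip n (t - 1) t \<longleftrightarrow> family_F n (t - 1) t E))"
proof -
  define k where "k = t - 2"
  have t: "t = k + 2" using assms by (simp add: k_def)
  have t1: "t - 1 = k + 1" using t by simp
  obtain N where N: "\<And>n E. N \<le> n \<Longrightarrow> saturated n k E \<Longrightarrow> saturated.good n k E" "k \<le> N"
  proof -
    define a where "a = 2 * k + (k + 1) * 2 ^ (2 * k)"
    define D where "D = (k + 1) * 2 ^ a"
    define b where "b = (k + 1) * (2 * D * D) + (k + 1) * (a + 2 * k * a)"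
    define m where "m = 2 * k * a + a + b"
    define C where "C = a + b + D + (k + 2) * m"
    define C1 where "C1 = C + C * C"
    define c where "c = C1 + 2 * C * (C + C1) + C + k + 2"
    \<comment> \<open>The summand 1 gives the strict inequality \<open>large\<close>, and
      \<open>k\<close> gives \<open>k \<le> N\<close>, which the witness graph needs.\<close>
    show thesis
    proof (rule that[of "(k + 2) * c + 1 + k"])
      fix n E assume "(k + 2) * c + 1 + k \<le> n" "saturated n k E"
      then show "saturated.good n k E"
        by (intro saturated.good_large[OF _ a_def D_def b_def m_def C_def C1_def c_def]) simp_all
    qed simp
  qed
  show ?thesis
  proof (intro exI[of _ N] allI impI)
    fix n assume n: "N \<le> n"
    let ?Sat = "{E. Kst_saturated n (k + 1) (k + 2) E}"
    have kn: "k \<le> n" using N(2) n by simp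
    have good: "(2 * k + 1) * n \<le> card E + k * (k + 1)"
      "card E + k * (k + 1) = (2 * k + 1) * n \<Longrightarrow> family_F n (k + 1) (k + 2) E"
      if "Kst_saturated n (k + 1) (k + 2) E" for E
    proof -
      have s: "saturated n k E" using that by (simp add: saturated_def)
      show "(2 * k + 1) * n \<le> card E + k * (k + 1)"
        "card E + k * (k + 1) = (2 * k + 1) * n \<Longrightarrow> family_F n (k + 1) (k + 2) E"
        using N(1)[OF n s] unfolding saturated.good_def[OF s] by blast+
    qed
    have "?Sat \<subseteq> Pow ({..<n} \<times> {..<n})" by (auto simp: Kst_saturated_def bip_graph_def)
    then have fin: "finite ?Sat" by (rule finite_subset) simp
    have ext: "card (extremal_graph n k) + k * (k + 1) = (2 * k + 1) * n"
      using family_F_card extremal_graph_family(2)[OF kn] kn by blast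
    have "sat_bip n (k + 1) (k + 2) = card (extremal_graph n k)"
      unfolding sat_bip_def
    proof (rule Min_eqI)
      show "card (extremal_graph n k) \<in> card ` ?Sat" using extremal_graph_family(1)[OF kn] by blast
      show "card (extremal_graph n k) \<le> y" if "y \<in> card ` ?Sat" for y
        using that good(1) ext by fastforce
    qed (use fin in simp)
    then have sat: "sat_bip n (k + 1) (k + 2) + k * (k + 1) = (2 * k + 1) * n" using ext by simp
    then have "int (sat_bip n (k + 1) (k + 2)) + int (k * (k + 1)) = int ((2 * k + 1) * n)"
      by (metis of_nat_add)
    then have "int (sat_bip n (k + 1) (k + 2)) = (2 * int t - 3) * int n - (int t - 1) * (int t - 2)"
      unfolding t by (simp add: algebra_simps)
    moreover have "card E = sat_bip n (k + 1) (k + 2) \<longleftrightarrow> family_F n (k + 1) (k + 2) E"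
      if "Kst_saturated n (k + 1) (k + 2) E" for E
      using good(2)[OF that] family_F_card[of n k E] kn sat by (metis add_right_cancel)
    ultimately show "int (sat_bip n (t - 1) t) = (2 * int t - 3) * int n - (int t - 1) * (int t - 2) \<and>
        (\<forall>E. Kst_saturated n (t - 1) t E \<longrightarrow>
          (card E = sat_bip n (t - 1) t \<longleftrightarrow> family_F n (t - 1) t E))"
      unfolding t1 by (simp only: t) blast
  qed
qed

end
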